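(* The following are equivalent for a semigroup $S$: (1) For each finite coloring of $S$, there is an infinite almost-monochromatic subsemigroup of $S$. (2) For each $2$-coloring of $S$, there is an infinite almost-monochromatic subsemigroup of $S$. (3) At least one of the following holds: (a) $S$ has an infinite, finitely synchronizing subsemigroup; (b) $S$ has a subsemigroup isomorphic to the group $\bigoplus_n\mathbb{Z}_2$.
   Context: A finite coloring of a set assigns one of finitely many colors to each element; a $2$-coloring uses two colors. A colored set $A$ is almost-monochromatic if all but finitely many members of $A$ have the same color. A semigroup $T$ is finitely synchronizing if there is a finite $F\subseteq T$ such that $ab\in\{a,b\}\cup F$ for all $a,b\in T$. $\bigoplus_n\mathbb{Z}_2$ is the additive group of all finitely supported elements of $\mathbb{Z}_2^{\mathbb{N}}$ with pointwise addition, $\mathbb{Z}_2$ being the two-element group. *)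

theory Defs
  imports "HOL-Library.Poly_Mapping" "HOL-Library.Z2"
begin

text \<open>The semigroup \<open>S\<close> is the universe of a type of class \<open>semigroup_mult\<close>;
  its subsemigroups are subsets of that type.\<close>

definition subsemigroup :: "'a::semigroup_mult set \<Rightarrow> bool" where
  "subsemigroup T \<longleftrightarrow> T \<noteq> {} \<and> (\<forall>a\<in>T. \<forall>b\<in>T. a * b \<in> T)"

text \<open>A coloring with \<open>k\<close> available colors; not every color has to occur.\<close>

definition coloring :: "nat \<Rightarrow> ('a \<Rightarrow> nat) \<Rightarrow> bool" where
  "coloring k c \<longleftrightarrow> (\<forall>x. c x < k)"

definition finite_coloring :: "('a \<Rightarrow> nat) \<Rightarrow> bool" where
  "finite_coloring c \<longleftrightarrow> (\<exists>k. coloring k c)"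

definition almost_monochromatic :: "('a \<Rightarrow> nat) \<Rightarrow> 'a set \<Rightarrow> bool" where
  "almost_monochromatic c A \<longleftrightarrow> (\<exists>i. finite {x \<in> A. c x \<noteq> i})"

definition finitely_synchronizing :: "'a::semigroup_mult set \<Rightarrow> bool" where
  "finitely_synchronizing T \<longleftrightarrow>
     (\<exists>F. finite F \<and> F \<subseteq> T \<and> (\<forall>a\<in>T. \<forall>b\<in>T. a * b \<in> {a, b} \<union> F))"

text \<open>The direct sum of countably many copies of the two-element group is the additive group of
  the type \<open>nat \<Rightarrow>\<^sub>0 bit\<close> of finitely supported functions with pointwise addition. It is
  written additively, the ambient semigroup multiplicatively.\<close>

definition isomorphic_to_direct_sum_Z2 :: "'a::semigroup_mult set \<Rightarrow> bool" where
  "isomorphic_to_direct_sum_Z2 T \<longleftrightarrow>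
     (\<exists>\<phi> :: (nat \<Rightarrow>\<^sub>0 bit) \<Rightarrow> 'a.
        bij_betw \<phi> UNIV T \<and> (\<forall>x y. \<phi> (x + y) = \<phi> x * \<phi> y))"

end

theory Submission
  imports Defs "HOL-Library.Infinite_Set" "HOL-Library.FuncSet"
begin

text \<open>
  In a finitely synchronizing semigroup with exceptional finite set \<open>F\<close>, the union of \<open>F\<close> with any
  color class is a subsemigroup. For a direct sum of copies of the two-element group, an idempotent ultrafilter
  (Galvin--Glazer) allows one to enlarge a finite subgroup step by step, keeping all its nontrivial
  elements in one color.

  Conversely, color so that a nonperiodic element and its square, and a periodic group element
  and its inverse (if distinct), get different colors. An almost-monochromatic infinite
  subsemigroup is then periodic. By a theorem of Shevrin it contains an infinite finitely
  synchronizing subsemigroup or an infinite group. In the latter case almost all elements of the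
  group are involutions, which forces every element to be one.

  Shevrin's theorem for a periodic semigroup \<open>R\<close>: if \<open>e R e\<close> is finite for all idempotents \<open>e\<close>, then all
  \<open>R x\<close> are finite, and Ramsey-type thinning of a sequence produces a finitely synchronizing
  subsemigroup. If this never happens in a subsemigroup, then passing to \<open>e R e\<close> without its finite
  group of units again and again produces an infinite descending chain of idempotents.
\<close>

section \<open>Powers and periodic elements\<close>

text \<open>The coloring has to exclude nonperiodic elements: the powers of one form a copy of the
  additive positive integers, where neither alternative of the third condition holds. Its two
  requirements are met by a single self-map, squaring on nonperiodic elements and inversion on
  periodic group elements, with colors alternating along its orbits. The orbits that matter have no
  odd cycle, so two colors suffice.

  The finite exceptional set is essential in the Ramsey arguments: an infinite semigroup with
  constant multiplication already needs it, and most cases end by forcing products of distinct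
  generators into a finite set.

  The descent through \<open>e R e\<close> works because in a periodic monoid an element with a
  one-sided inverse is a unit. Hence the nonunits are closed under multiplication, and any
  idempotent among them lies strictly below \<open>e\<close>.

  Ultrafilters are handled through filters. A filter stands for the closed set of ultrafilters below
  it, and \<open>F \<le> G\<close> for inclusion of these sets, so minimal closed sets and single
  ultrafilters both come from Zorn's lemma for filters.\<close>

text \<open>There is no neutral element, so exponents are shifted: \<open>spow x n\<close> is \<open>x\<close> to the power \<open>n + 1\<close>.\<close>

primrec spow :: "'a::semigroup_mult \<Rightarrow> nat \<Rightarrow> 'a" where
  "spow x 0 = x"
| "spow x (Suc n) = x * spow x n"

definition periodic :: "'a::semigroup_mult \<Rightarrow> bool" where
  "periodic x \<longleftrightarrow> finite (range (spow x))"

lemma spow_mult: "spow x m * spow x n = spow x (m + n + 1)"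
  by (induction m) (simp_all add: mult.assoc)

lemma spow_spow: "spow (spow x m) n = spow x (m * n + m + n)"
  by (induction n) (simp_all add: spow_mult algebra_simps)

lemma mult_spow_commute: "x * spow x n = spow x n * x"
  using spow_mult[of x 0 n] spow_mult[of x n 0] by simp

lemma spow_in: "subsemigroup R \<Longrightarrow> x \<in> R \<Longrightarrow> spow x n \<in> R"
  by (induction n) (auto simp: subsemigroup_def)

lemma spow_idem: "e * e = e \<Longrightarrow> spow e n = e"
  by (induction n) auto

text \<open>Multiplying one coincidence of powers by further powers carries it to all later
  exponents, so \<open>d\<close> is a period from \<open>m\<close> on.\<close>

lemma spow_shift:
  assumes "spow x m = spow x (m + d)" "m \<le> n"
  shows "spow x (n + d * t) = spow x n"
proof -
  have 1: "spow x (n + d) = spow x n" if "m \<le> n" for n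
  proof (cases "n = m")
    case False
    define k where "k = n - m - 1"
    have n: "n = m + k + 1" using that False by (simp add: k_def)
    have "spow x (n + d) = spow x (m + d) * spow x k"
      by (simp add: spow_mult n algebra_simps)
    also have "\<dots> = spow x n" by (simp add: assms(1)[symmetric] spow_mult n)
    finally show ?thesis .
  qed (use assms in simp)
  show ?thesis
  proof (induction t)
    case (Suc t)
    have "spow x (n + d * Suc t) = spow x ((n + d * t) + d)" by (simp add: algebra_simps)
    also have "\<dots> = spow x (n + d * t)" using assms(2) by (intro 1) simp
    finally show ?case using Suc by simp
  qed simp
qed

lemma nonperiodic_inj_spow:
  assumes "\<not> periodic x"
  shows "inj (spow x)"
proof (rule ccontr)
  assume "\<not> inj (spow x)"
  then obtain m n where mn: "m < n" "spow x m = spow x n"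
    by (metis injI linorder_neqE_nat)
  define d where "d = n - m"
  have d: "d > 0" "spow x m = spow x (m + d)" using mn by (auto simp: d_def)
  have "spow x k \<in> spow x ` {..m + d}" for k
  proof (cases "k \<le> m + d")
    case False
    have "k = (m + (k - m) mod d) + d * ((k - m) div d)" using False by simp
    then have "spow x k = spow x (m + (k - m) mod d)"
      using spow_shift[OF d(2), of "m + (k - m) mod d" "(k - m) div d"] by simp
    moreover have "m + (k - m) mod d \<le> m + d" using d(1) by (simp add: less_imp_le)
    ultimately show ?thesis by blast
  qed blast
  then have "finite (range (spow x))"
    by (meson finite_atMost finite_imageI finite_subset image_subsetI)
  with assms show False by (simp add: periodic_def)
qed

lemma periodic_idempotent_power:
  assumes "periodic x"
  obtains k where "spow x k * spow x k = spow x k"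
proof -
  have "\<not> inj (spow x)"
    using assms finite_imageD[of "spow x" UNIV] by (auto simp: periodic_def)
  then obtain m n where mn: "m < n" "spow x m = spow x n"
    by (metis injI linorder_neqE_nat)
  define d where "d = n - m"
  have d: "d > 0" "spow x m = spow x (m + d)" using mn by (auto simp: d_def)
  \<comment> \<open>The true exponent \<open>k + 1\<close> is a multiple of the period
    \<open>d\<close>, and squaring shifts the exponent by exactly \<open>k + 1\<close>; the factor
    \<open>m + 1\<close> places \<open>k\<close> past the preperiod.\<close>
  define k where "k = d * (m + 1) - 1"
  have "d * (m + 1) \<ge> 1 * (m + 1)" using d(1) by (intro mult_right_mono) auto
  then have k: "k \<ge> m" "k + 1 = d * (m + 1)" by (auto simp: k_def)
  have "spow x k * spow x k = spow x (k + d * (m + 1))"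
    unfolding spow_mult k(2)[symmetric] by (simp add: algebra_simps)
  also have "\<dots> = spow x k" by (rule spow_shift[OF d(2) k(1)])
  finally show thesis by (rule that)
qed

section \<open>Infinite finitely synchronizing subsemigroups\<close>

definition contains_fs :: "'a::semigroup_mult set \<Rightarrow> bool" where
  "contains_fs R \<longleftrightarrow> (\<exists>T\<subseteq>R. subsemigroup T \<and> infinite T \<and> finitely_synchronizing T)"

lemma contains_fs_mono: "contains_fs R \<Longrightarrow> R \<subseteq> R' \<Longrightarrow> contains_fs R'"
  unfolding contains_fs_def by blast

lemma contains_fsI:
  assumes "infinite A" "A \<subseteq> R" "finite F" "F \<subseteq> R"
    "\<And>a b. a \<in> A \<union> F \<Longrightarrow> b \<in> A \<union> F \<Longrightarrow> a * b \<in> {a, b} \<union> F"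
  shows "contains_fs R"
  unfolding contains_fs_def
proof (intro exI conjI)
  show "A \<union> F \<subseteq> R" using assms by simp
  show "infinite (A \<union> F)" using assms by simp
  show "subsemigroup (A \<union> F)"
    unfolding subsemigroup_def using assms(1,5) by (metis Un_iff empty_iff infinite_imp_nonempty insertE sup_bot.neutr_eq_iff)
  show "finitely_synchronizing (A \<union> F)"
    unfolding finitely_synchronizing_def using assms(3,5) by (intro exI[of _ F]) auto
qed

section \<open>Thinning of sequences\<close>

text \<open>The first half of the usual proof of Ramsey's theorem, kept separate because later uses
  have rows that are finite one by one but not uniformly. The constant value may depend on the
  row.\<close>

lemma thinning:
  fixes g :: "nat \<Rightarrow> nat \<Rightarrow> 'b"
  assumes fin: "\<And>i. finite {g i j | j. i < j}"
  obtains s :: "nat \<Rightarrow> nat" where "strict_mono s" "\<And>i j k. i < j \<Longrightarrow> i < k \<Longrightarrow> g (s i) (s j) = g (s i) (s k)"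
proof -
  \<comment> \<open>A state is the index just chosen together with an infinite reservoir of later
    indices on which its row is constant.\<close>
  define P where "P = (\<lambda>(n::nat) (p :: nat \<times> nat set). infinite (snd p) \<and> (\<forall>j\<in>snd p. fst p < j) \<and>
      (\<forall>j\<in>snd p. \<forall>k\<in>snd p. g (fst p) j = g (fst p) k))"
  define Q where "Q = (\<lambda>(n::nat) (p :: nat \<times> nat set) q. fst q \<in> snd p \<and> snd q \<subseteq> snd p)"
  have step: "\<exists>q. P n q \<and> fst q \<in> A \<and> snd q \<subseteq> A" if "infinite A" for A n
  proof -
    obtain a where a: "a \<in> A" using infinite_imp_nonempty[OF \<open>infinite A\<close>] by blast
    have inf: "infinite (A \<inter> {a<..})"
    proof
      assume "finite (A \<inter> {a<..})"
      then have "finite ((A \<inter> {a<..}) \<union> {..a})" by simp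
      moreover have "A \<subseteq> (A \<inter> {a<..}) \<union> {..a}" by auto
      ultimately show False using that finite_subset by blast
    qed
    have "finite (g a ` (A \<inter> {a<..}))"
      by (rule finite_subset[OF _ fin[of a]]) auto
    then obtain j where "j \<in> A \<inter> {a<..}" "infinite {k \<in> A \<inter> {a<..}. g a k = g a j}"
      using pigeonhole_infinite[OF inf] by blast
    then show ?thesis using a
      by (intro exI[of _ "(a, {k \<in> A \<inter> {a<..}. g a k = g a j})"]) (auto simp: P_def)
  qed
  have "\<exists>f. \<forall>n. P n (f n) \<and> Q n (f n) (f (Suc n))"
  proof (rule dependent_nat_choice)
    show "\<exists>x. P 0 x" using step[of UNIV 0] by auto
    show "\<exists>y. P (Suc n) y \<and> Q n x y" if "P n x" for x n
      using step[of "snd x" "Suc n"] that by (auto simp: P_def Q_def)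
  qed
  then obtain f where f: "\<And>n. P n (f n)" "\<And>n. Q n (f n) (f (Suc n))" by blast
  define s where "s n = fst (f n)" for n
  have sub: "snd (f j) \<subseteq> snd (f i)" if "i \<le> j" for i j
    by (rule lift_Suc_antimono_le[OF _ that]) (use f(2) in \<open>auto simp: Q_def\<close>)
  have mem: "s j \<in> snd (f i)" if "i < j" for i j
  proof -
    obtain k where k: "j = Suc k" "i \<le> k" using \<open>i < j\<close> by (cases j) auto
    show ?thesis using f(2)[of k] sub[OF k(2)] by (auto simp: Q_def s_def k)
  qed
  show thesis
  proof
    show "strict_mono s"
      by (rule strict_monoI) (use mem f(1) in \<open>auto simp: P_def s_def\<close>)
    show "g (s i) (s j) = g (s i) (s k)" if "i < j" "i < k" for i j k
      using mem that f(1)[of i] by (auto simp: P_def s_def)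
  qed
qed

text \<open>After thinning, row \<open>i\<close> has a single value; the pigeonhole principle on
  these values makes it independent of \<open>i\<close>.\<close>

lemma ramsey_pairs:
  fixes g :: "nat \<Rightarrow> nat \<Rightarrow> 'b"
  assumes "finite H" "\<And>i j. i < j \<Longrightarrow> g i j \<in> H"
  obtains s :: "nat \<Rightarrow> nat" and b where "strict_mono s" "\<And>i j. i < j \<Longrightarrow> g (s i) (s j) = b"
proof -
  have "finite {g i j | j. i < j}" for i
    by (rule finite_subset[OF _ assms(1)]) (use assms(2) in auto)
  then obtain s :: "nat \<Rightarrow> nat" where s: "strict_mono s" "\<And>i j k. i < j \<Longrightarrow> i < k \<Longrightarrow> g (s i) (s j) = g (s i) (s k)"
    using thinning by blast
  have "range (\<lambda>i. g (s i) (s (Suc i))) \<subseteq> H"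
    using assms(2) s(1) by (auto simp: strict_mono_def)
  then have "finite (range (\<lambda>i. g (s i) (s (Suc i))))" using assms(1) finite_subset by blast
  then obtain i0 where i0: "infinite {i \<in> UNIV. g (s i) (s (Suc i)) = g (s i0) (s (Suc i0))}"
    using pigeonhole_infinite[of UNIV "\<lambda>i. g (s i) (s (Suc i))"] by auto
  obtain r :: "nat \<Rightarrow> nat" where r: "strict_mono r"
    "\<And>n. r n \<in> {i \<in> UNIV. g (s i) (s (Suc i)) = g (s i0) (s (Suc i0))}"
    using infinite_enumerate[OF i0] by blast
  show thesis
  proof
    show "strict_mono (s \<circ> r)" using s(1) r(1) by (simp add: strict_mono_def)
    show "g ((s \<circ> r) i) ((s \<circ> r) j) = g (s i0) (s (Suc i0))" if "i < j" for i j
    proof -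
      have "r i < r j" using r(1) that by (simp add: strict_mono_def)
      then show ?thesis using s(2)[of "r i" "r j" "Suc (r i)"] r(2)[of i] by simp
    qed
  qed
qed

section \<open>Sequences with restricted products\<close>

text \<open>After thinning, all products of generators that are not powers of a single one lie in a finite
  absorbing set \<open>Z\<close>. An element outside \<open>Z\<close> that is a power of two different generators multiplies
  all such elements into \<open>Z\<close>. If there are infinitely many of them, they suffice; otherwise add them to
  \<open>Z\<close> and take from every generator its last power outside the resulting set.\<close>

lemma contains_fs_if_finite_offdiagonal:
  assumes R: "subsemigroup R" and A: "infinite A" "A \<subseteq> R" "\<And>x. x \<in> A \<Longrightarrow> periodic x"
    and H: "finite H" "\<And>a b. a \<in> A \<Longrightarrow> b \<in> A \<Longrightarrow> a \<noteq> b \<Longrightarrow> a * b \<in> H"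
  shows "contains_fs R"
proof -
  note ma = mult.assoc
  obtain a :: "nat \<Rightarrow> 'a" where a: "inj a" "range a \<subseteq> A"
    using infinite_countable_subset[OF A(1)] by blast
  \<comment> \<open>Coloring a pair of indices by both products at once lets one application of
    Ramsey's theorem fix both orders.\<close>
  have aH: "(a i * a j, a j * a i) \<in> H \<times> H" if "i < j" for i j
    using that a by (auto intro!: H(2) simp: inj_def)
  obtain s :: "nat \<Rightarrow> nat" and bh where s: "strict_mono s" "\<And>i j. i < j \<Longrightarrow> (a (s i) * a (s j), a (s j) * a (s i)) = bh"
    by (rule ramsey_pairs[of "H \<times> H" "\<lambda>i j. (a i * a j, a j * a i)"]) (use aH H(1) in auto)
  obtain b h where bh: "bh = (b, h)" by fastforce
  define y where "y i = a (s i)" for i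
  have yb: "y i * y j = b" and yh: "y j * y i = h" if "i < j" for i j
    using s(2)[OF that] by (auto simp: bh y_def)
  \<comment> \<open>Associativity of \<open>y i * y (Suc i) * y k\<close>; the gap of two leaves
    room for the middle index. As \<open>i\<close> and \<open>k\<close> vary independently, both
    sides are one constant, named \<open>p\<close> below.\<close>
  have b1: "y i * b = b * y k" if "i + 2 \<le> k" for i k
    using yb[of i "Suc i"] yb[of "Suc i" k] that ma[of "y i" "y (Suc i)" "y k"] by simp
  have h1: "h * y i = y k * h" if "i + 2 \<le> k" for i k
    using yh[of i "Suc i"] yh[of "Suc i" k] that ma[of "y k" "y (Suc i)" "y i"] by simp
  define p where "p = y 0 * b"
  have byp: "b * y k = p" if "2 \<le> k" for k using b1[of 0 k] that by (simp add: p_def)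
  have yb': "y i * b = p" for i using b1[of i "i + 2"] byp[of "i + 2"] by simp
  have yh': "y k * h = h * y 0" if "2 \<le> k" for k using h1[of 0 k] that by simp
  have hy': "h * y i = h * y 0" for i using h1[of i "i + 2"] yh'[of "i + 2"] by simp
  \<comment> \<open>Bracketing \<open>y 2 * y 3 * y 2\<close> in both ways identifies the constant
    obtained from \<open>h\<close> with the one obtained from \<open>b\<close>.\<close>
  have hp: "h * y 0 = p"
    using ma[of "y 2" "y 3" "y 2"] yb[of 2 3] yh[of 2 3] byp[of 2] yh'[of 2] by simp
  \<comment> \<open>Multiplication by \<open>b\<close> from the left and by \<open>h\<close> from
    the right is constant only from index 2 on; the shift removes this exception.\<close>
  define x where "x i = y (i + 2)" for i
  have xA: "x i \<in> A" for i using a(2) by (auto simp: x_def y_def)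
  have xR: "x i \<in> R" for i using xA A(2) by blast
  have xinj: "inj x"
    by (auto simp: inj_def x_def y_def inj_eq[OF a(1)] strict_mono_eq[OF s(1)])
  have xb: "x i * b = p" and bx: "b * x i = p" and xh: "x i * h = p" and hx: "h * x i = p" for i
    using yb' byp hp yh' hy' by (auto simp: x_def)
  have xx: "x i * x j \<in> {b, h}" if "i \<noteq> j" for i j
    using that yb[of "i + 2" "j + 2"] yh[of "j + 2" "i + 2"] by (cases "i < j") (auto simp: x_def)
  have b01: "b = x 0 * x 1" "h = x 1 * x 0"
    using yb[of 2 3] yh[of 2 3] by (simp_all add: x_def numeral_3_eq_3 numeral_2_eq_2)
  have px: "p * x i = x j * p" for i j
    using ma[of "x j" h "x i"] by (simp add: xh hx)
  \<comment> \<open>A product of \<open>n + 3\<close> generators that are not all equal depends only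
    on its length and is \<open>z n\<close>; for length 2 it is \<open>b\<close> or
    \<open>h\<close>. Periodicity of \<open>x 0\<close> makes the range of \<open>z\<close>
    finite.\<close>
  define z where "z n = ((*) (x 0) ^^ n) p" for n
  have z0: "z 0 = p" and zS: "z (Suc n) = x 0 * z n" for n by (simp_all add: z_def)
  have zx: "z n * x i = z (Suc n)" for n i
    by (induction n) (simp_all add: z0 zS px[of i 0] ma)
  have xz: "x i * z n = z (Suc n)" for n i
  proof (induction n)
    case 0
    show ?case using px[of 0 i] px[of 0 0] by (simp add: z0 zS)
  next
    case (Suc n)
    have "x i * z (Suc n) = (x i * z n) * x 0" by (simp only: ma zx)
    then show ?case by (simp only: Suc zx)
  qed
  define Z where "Z = {b, h} \<union> range z"
  have "z n \<in> insert p ((\<lambda>u. u * p) ` range (spow (x 0)))" for n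
  proof (cases n)
    case (Suc m)
    have "z (Suc m) = spow (x 0) m * p" for m
      by (induction m) (simp_all add: z0 zS ma)
    then show ?thesis by (auto simp: Suc)
  qed (simp add: z0)
  moreover have "finite (range (spow (x 0)))" using A(3)[OF xA] by (simp add: periodic_def)
  ultimately have "finite (range z)"
    by (meson finite_imageI finite_insert finite_subset image_subsetI)
  then have Zfin: "finite Z" by (simp add: Z_def)
  have multR: "u * v \<in> R" if "u \<in> R" "v \<in> R" for u v using R that by (auto simp: subsemigroup_def)
  have "b \<in> R" "h \<in> R" using b01 xR multR by auto
  moreover have "p \<in> R" using xb[of 0] xR calculation multR by metis
  moreover have "z n \<in> R" for n by (induction n) (use calculation in \<open>auto simp: z0 zS xR multR\<close>)
  ultimately have ZR: "Z \<subseteq> R" by (auto simp: Z_def)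
  have pZ: "p \<in> Z" using z0 by (metis UnI2 Z_def rangeI)
  have xZ: "x i * u \<in> Z" and Zx: "u * x i \<in> Z" if "u \<in> Z" for u i
    using that pZ by (auto simp: Z_def xb xh bx hx xz zx)
  have sZ: "spow (x i) n * u \<in> Z" if "u \<in> Z" for u i n
    by (induction n) (use that xZ in \<open>auto simp: ma\<close>)
  have Zs: "u * spow (x i) n \<in> Z" if "u \<in> Z" for u i n
    using that by (induction n arbitrary: u) (auto simp: Zx ma[symmetric])
  have ZZ: "u * v \<in> Z" if "u \<in> Z" "v \<in> Z" for u v
  proof -
    have Zb: "u * b \<in> Z" "u * h \<in> Z" if "u \<in> Z" for u
      using that by (auto simp: b01 ma[symmetric] Zx)
    have Zz: "u * z n \<in> Z" if "u \<in> Z" for u n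
      using that
    proof (induction n arbitrary: u)
      case 0
      then show ?case using Zb(1)[OF Zx[of u 0]] xb[of 0] by (simp add: z0 ma)
    next
      case (Suc n)
      then show ?case by (simp add: zS ma[symmetric] Zx)
    qed
    show ?thesis using that(2) Zb[OF that(1)] Zz[OF that(1)] by (auto simp: Z_def)
  qed
  have ss: "spow (x i) m * spow (x j) n \<in> Z" if "i \<noteq> j" for i j m n
  proof -
    have 1: "x i * x j \<in> Z" using xx[OF that] by (auto simp: Z_def)
    have 2: "x i * spow (x j) n \<in> Z"
      by (cases n) (use 1 in \<open>auto simp: ma[symmetric] Zs\<close>)
    show ?thesis by (induction m) (use 2 in \<open>auto simp: ma xZ\<close>)
  qed
  define W where "W = {w. w \<notin> Z \<and> (\<exists>i j m n. i \<noteq> j \<and> w = spow (x i) m \<and> w = spow (x j) n)}"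
  \<comment> \<open>A member of \<open>W\<close> is a power of two different generators, so one of
    them differs from any prescribed \<open>k\<close>, and \<open>ss\<close> applies.\<close>
  have Wrep: "\<exists>j n. j \<noteq> k \<and> w = spow (x j) n" if "w \<in> W" for w k
  proof -
    have "\<exists>i j m n. i \<noteq> j \<and> w = spow (x i) m \<and> w = spow (x j) n"
      using \<open>w \<in> W\<close> by (simp add: W_def)
    then obtain i j m n where "i \<noteq> j" "w = spow (x i) m" "w = spow (x j) n" by blast
    then show ?thesis by metis
  qed
  have Ws: "w * spow (x k) n \<in> Z" and sW: "spow (x k) n * w \<in> Z" if "w \<in> W" for w k n
    using Wrep[OF that, of k] ss by (metis, metis)
  have WW: "w * w' \<in> Z" if "w \<in> W" "w' \<in> W" for w w'
    using Ws[OF that(1)] Wrep[OF that(2), of 0] by metis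
  have WZ: "w * u \<in> Z" and ZW: "u * w \<in> Z" if "w \<in> W" "u \<in> Z" for w u
    using Wrep[OF that(1), of 0] sZ[OF that(2)] Zs[OF that(2)] by metis+
  have WR: "W \<subseteq> R" using spow_in[OF R xR] by (auto simp: W_def)
  show ?thesis
  proof (cases "finite W")
    case False
    show ?thesis
      by (rule contains_fsI[OF False WR Zfin ZR]) (use WW WZ ZW ZZ in blast)
  next
    case True
    define F where "F = Z \<union> W"
    define I where "I = {i. x i \<notin> F}"
    have Ffin: "finite F" using True Zfin by (simp add: F_def)
    have FR: "F \<subseteq> R" using WR ZR by (simp add: F_def)
    have Fs: "u * spow (x k) n \<in> F" and sF: "spow (x k) n * u \<in> F" if "u \<in> F" for u k n
      using that Ws sW sZ Zs by (auto simp: F_def)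
    have FF: "u * v \<in> F" if "u \<in> F" "v \<in> F" for u v
      using that WW WZ ZW ZZ by (auto simp: F_def)
    have "infinite I"
    proof
      assume "finite I"
      moreover have "finite (x -` F)" using Ffin xinj by (rule finite_vimageI)
      moreover have "UNIV = I \<union> x -` F" by (auto simp: I_def)
      ultimately show False by (metis finite_Un infinite_UNIV_nat)
    qed
    \<comment> \<open>If the idempotent power avoids \<open>F\<close>, it is taken. Otherwise the
      power just before the first one in \<open>F\<close> is taken: its square is that first power,
      possibly times a further power, and \<open>F\<close> absorbs powers.\<close>
    have "\<exists>n. spow (x i) n \<notin> F \<and> spow (x i) n * spow (x i) n \<in> insert (spow (x i) n) F"
      if "i \<in> I" for i
    proof -
      obtain k where k: "spow (x i) k * spow (x i) k = spow (x i) k"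
        using periodic_idempotent_power[OF A(3)[OF xA]] by blast
      show ?thesis
      proof (cases "spow (x i) k \<in> F")
        case True
        define m where "m = (LEAST n. spow (x i) n \<in> F)"
        have m: "spow (x i) m \<in> F" using LeastI[of "\<lambda>n. spow (x i) n \<in> F", OF True] by (simp add: m_def)
        have "m \<noteq> 0" using m \<open>i \<in> I\<close> by (auto simp: I_def intro: ccontr)
        then obtain n where n: "m = Suc n" using not0_implies_Suc by blast
        have "spow (x i) n \<notin> F" using not_less_Least[of n "\<lambda>n. spow (x i) n \<in> F"] n by (simp add: m_def)
        moreover have "spow (x i) n * spow (x i) n \<in> F"
        proof (cases n)
          case 0
          then show ?thesis using m n by simp
        next
          case (Suc l)
          have "spow (x i) n * spow (x i) n = spow (x i) m * spow (x i) l"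
            by (simp only: spow_mult) (simp add: n Suc)
          then show ?thesis using Fs[OF m] by simp
        qed
        ultimately show ?thesis by blast
      qed (use k in auto)
    qed
    then obtain N where N: "\<And>i. i \<in> I \<Longrightarrow> spow (x i) (N i) \<notin> F"
      "\<And>i. i \<in> I \<Longrightarrow> spow (x i) (N i) * spow (x i) (N i) \<in> insert (spow (x i) (N i)) F"
      by metis
    define t where "t i = spow (x i) (N i)" for i
    have "inj_on t I"
    proof (rule inj_onI, rule ccontr)
      fix i j assume ij: "i \<in> I" "j \<in> I" "t i = t j" "i \<noteq> j"
      then have "t i \<in> F" unfolding F_def W_def t_def by blast
      with N(1)[OF ij(1)] show False by (simp add: t_def)
    qed
    then have "infinite (t ` I)" using \<open>infinite I\<close> finite_imageD by blast
    moreover have "t ` I \<subseteq> R" using spow_in[OF R xR] by (auto simp: t_def)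
    moreover have "u * v \<in> {u, v} \<union> F" if uv: "u \<in> t ` I \<union> F" "v \<in> t ` I \<union> F" for u v
    proof -
      have "t i * t j \<in> insert (t i) F" if "i \<in> I" for i j
        using N(2)[OF that] ss[of i j] by (cases "i = j") (auto simp: t_def F_def)
      then show ?thesis using uv FF Fs sF by (fastforce simp: t_def)
    qed
    ultimately show ?thesis using contains_fsI[OF _ _ Ffin FR] by blast
  qed
qed

text \<open>For fixed \<open>i\<close>, the products \<open>f i * f j\<close> with
  \<open>j > i\<close> multiply as a right zero semigroup, which suffices if there are infinitely
  many. Otherwise thinning makes them a single \<open>b i\<close> for each \<open>i\<close>, and any
  two \<open>b i\<close> multiply to the one with smaller index.\<close>

lemma contains_fs_if_right_absorbing_idempotents:
  fixes f :: "nat \<Rightarrow> 'a::semigroup_mult"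
  assumes R: "subsemigroup R" and f: "inj f" "\<And>i. f i \<in> R" "\<And>i. f i * f i = f i"
    and ff: "\<And>i j. i < j \<Longrightarrow> f j * f i = f i"
  shows "contains_fs R"
proof -
  note ma = mult.assoc
  have multR: "u * v \<in> R" if "u \<in> R" "v \<in> R" for u v using R that by (auto simp: subsemigroup_def)
  show ?thesis
  proof (cases "\<forall>i. finite {f i * f j | j. i < j}")
    case False
    then obtain i where i: "infinite {f i * f j | j. i < j}" by blast
    show ?thesis
    proof (rule contains_fsI[OF i, of R "{}"])
      show "a * b \<in> {a, b} \<union> {}"
        if ab: "a \<in> {f i * f j | j. i < j} \<union> {}" "b \<in> {f i * f j | j. i < j} \<union> {}" for a b
      proof -
        obtain j k where jk: "i < j" "i < k" "a = f i * f j" "b = f i * f k" using ab by auto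
        have "a * b = f i * ((f j * f i) * f k)" by (simp add: jk ma)
        also have "\<dots> = b" using jk by (simp add: ff f(3) ma[symmetric])
        finally show ?thesis by simp
      qed
    qed (use f(2) multR in auto)
  next
    case True
    then obtain s :: "nat \<Rightarrow> nat" where s: "strict_mono s"
      "\<And>i j k. i < j \<Longrightarrow> i < k \<Longrightarrow> f (s i) * f (s j) = f (s i) * f (s k)"
      using thinning[of "\<lambda>i j. f i * f j"] by blast
    define e where "e i = f (s i)" for i
    define b where "b i = e i * e (Suc i)" for i
    have einj: "e i = e j \<longleftrightarrow> i = j" for i j
      by (simp add: e_def inj_eq[OF f(1)] strict_mono_eq[OF s(1)])
    have ee: "e i * e i = e i" for i by (simp add: e_def f(3))
    have dn: "e j * e i = e i" if "i < j" for i j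
      using that s(1) by (auto simp: e_def strict_mono_def intro!: ff)
    have up: "e i * e j = b i" if "i < j" for i j
      using s(2)[OF that, of "Suc i"] by (simp add: e_def b_def)
    have be: "b i * e j = b i" if "i < j" for i j
      using up[OF that] ee[of j] ma[of "e i" "e j" "e j"] by simp
    have eb: "e j * b i = b i" if "i < j" for i j
      using dn[OF that] by (simp add: b_def ma[symmetric])
    have bb1: "b i * b j = b i" if "i < j" for i j
      using be[OF that] be[of i "Suc j"] that by (simp add: b_def[of j] ma[symmetric])
    have bb2: "b j * b i = b i" if "i < j" for i j
      using eb[OF that] eb[of i "Suc j"] that by (simp add: b_def[of j] ma)
    have bb3: "b i * b i = b i" for i
      using eb[of i "Suc i"] ee[of i] by (simp add: b_def ma) (simp add: ma[symmetric] ee)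
    show ?thesis
    proof (cases "finite (range b)")
      case False
      show ?thesis
      proof (rule contains_fsI[OF False, of R "{}"])
        show "u * v \<in> {u, v} \<union> {}" if uv: "u \<in> range b \<union> {}" "v \<in> range b \<union> {}" for u v
        proof -
          obtain i j where "u = b i" "v = b j" using uv by auto
          then show ?thesis using bb1 bb2 bb3 by (cases i j rule: linorder_cases) auto
        qed
      qed (use f(2) multR in \<open>auto simp: b_def e_def\<close>)
    next
      case True
      then obtain i0 where "infinite {i \<in> UNIV. b i = b i0}"
        using pigeonhole_infinite[of UNIV b] by auto
      then obtain r :: "nat \<Rightarrow> nat" where r: "strict_mono r" "\<And>n. r n \<in> {i \<in> UNIV. b i = b i0}"
        using infinite_enumerate by blast
      have br: "b (r n) = b i0" for n using r(2) by simp
      have lt: "r m < r n" if "m < n" for m n using that r(1) by (simp add: strict_mono_def)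
      \<comment> \<open>Both factors of \<open>b (r (Suc n))\<close> act as left identities on
        \<open>e (r n)\<close>. Replacing this element by the equal \<open>b (r 0)\<close>, which
        absorbs \<open>e (r n)\<close> on its right, collapses distinct idempotents.\<close>
      have "e (r n) = b i0" if "0 < n" for n
      proof -
        have "e (r n) = b (r (Suc n)) * e (r n)"
          using dn[of "r n" "r (Suc n)"] dn[of "r n" "Suc (r (Suc n))"] lt[of n "Suc n"]
          by (simp add: b_def ma)
        also have "\<dots> = b (r 0) * e (r n)" by (simp add: br)
        also have "\<dots> = b i0" using be[OF lt[OF that]] by (simp add: br)
        finally show ?thesis .
      qed
      then have "e (r 1) = e (r 2)" by simp
      then show ?thesis using lt[of 1 2] by (simp add: einj)
    qed
  qed
qed

text \<open>Only products in decreasing index order are controlled. One of three infinite sets has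
  finitely many off-diagonal products: a row of increasing products, the row constants
  \<open>b i\<close> after thinning, or the thinned sequence itself.\<close>

lemma contains_fs_if_finite_decreasing_products:
  fixes x :: "nat \<Rightarrow> 'a::semigroup_mult"
  assumes R: "subsemigroup R" "\<And>x. x \<in> R \<Longrightarrow> periodic x" and x: "inj x" "\<And>i. x i \<in> R"
    and H: "finite H" "\<And>i j. i < j \<Longrightarrow> x j * x i \<in> H"
  shows "contains_fs R"
proof -
  note ma = mult.assoc
  have multR: "u * v \<in> R" if "u \<in> R" "v \<in> R" for u v using R that by (auto simp: subsemigroup_def)
  obtain s :: "nat \<Rightarrow> nat" and h where s: "strict_mono s" "\<And>i j. i < j \<Longrightarrow> x (s j) * x (s i) = h"
    by (rule ramsey_pairs[of H "\<lambda>i j. x j * x i"]) (use H in auto)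
  define y where "y i = x (s i)" for i
  have yinj: "y i = y j \<longleftrightarrow> i = j" for i j
    by (simp add: y_def inj_eq[OF x(1)] strict_mono_eq[OF s(1)])
  have yR: "y i \<in> R" for i by (simp add: y_def x)
  have yh: "y j * y i = h" if "i < j" for i j using s(2)[OF that] by (simp add: y_def)
  have h1: "h * y i = y k * h" if "i + 2 \<le> k" for i k
    using yh[of i "Suc i"] yh[of "Suc i" k] that ma[of "y k" "y (Suc i)" "y i"] by simp
  define q where "q = h * y 0"
  have hy: "h * y i = q" for i
    using h1[of i "i + 2"] h1[of 0 "i + 2"] by (simp add: q_def)
  note off = contains_fs_if_finite_offdiagonal[OF R(1)]
  show ?thesis
  proof (cases "\<forall>i. finite {y i * y j | j. i < j}")
    case False
    then obtain i where i: "infinite {y i * y j | j. i < j}" by blast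
    show ?thesis
    proof (rule off[OF i, of "{y i * q}"])
      show "a * b \<in> {y i * q}" if ab: "a \<in> {y i * y j | j. i < j}" "b \<in> {y i * y j | j. i < j}" for a b
      proof -
        obtain j k where jk: "i < j" "i < k" "a = y i * y j" "b = y i * y k" using ab by auto
        have "a * b = y i * ((y j * y i) * y k)" by (simp add: jk ma)
        then show ?thesis using jk by (simp add: yh hy)
      qed
    qed (use yR multR R(2) in auto)
  next
    case True
    then obtain t :: "nat \<Rightarrow> nat" where t: "strict_mono t"
      "\<And>i j k. i < j \<Longrightarrow> i < k \<Longrightarrow> y (t i) * y (t j) = y (t i) * y (t k)"
      using thinning[of "\<lambda>i j. y i * y j"] by blast
    define w where "w i = y (t i)" for i
    define b where "b i = w i * w (Suc i)" for i
    have winj: "inj w" by (simp add: inj_def w_def yinj strict_mono_eq[OF t(1)])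
    have wR: "w i \<in> R" for i by (simp add: w_def yR)
    have dn: "w j * w i = h" if "i < j" for i j
      using that t(1) by (simp add: w_def strict_mono_def yh)
    have up: "w i * w j = b i" if "i < j" for i j
      using t(2)[OF that, of "Suc i"] by (simp add: w_def b_def)
    have hw: "h * w i = q" for i by (simp add: w_def hy)
    \<comment> \<open>Writing \<open>q\<close> as \<open>w 2 * w 1 * w 0\<close> needs an
      \<open>i\<close> above 2, so that \<open>w i * w 2\<close> is again a decreasing
      product.\<close>
    have wq: "w i * q = h * h" if "3 \<le> i" for i
    proof -
      have "w i * q = w i * ((w 2 * w 1) * w 0)" using dn[of 1 2] hw[of 0] by simp
      also have "\<dots> = (w i * w 2) * (w 1 * w 0)" by (simp only: ma)
      also have "\<dots> = h * h" using dn[of 2 i] dn[of 0 1] that by simp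
      finally show ?thesis .
    qed
    \<comment> \<open>The second factor of \<open>b i\<close> may have any index above
      \<open>i\<close>; \<open>Suc (i + j)\<close> also exceeds \<open>j\<close> and so meets
      \<open>w j\<close> in decreasing order.\<close>
    have bb: "b i * b j = h * h" if "3 \<le> i" for i j
    proof -
      have "b i * b j = (w i * w (Suc (i + j))) * (w j * w (Suc j))"
        using up[of i "Suc (i + j)"] by (simp add: b_def[of j])
      also have "\<dots> = w i * ((w (Suc (i + j)) * w j) * w (Suc j))" by (simp only: ma)
      also have "\<dots> = h * h" using dn[of j "Suc (i + j)"] wq[OF that] by (simp add: hw)
      finally show ?thesis .
    qed
    show ?thesis
    proof (cases "finite (b ` {3..})")
      case False
      show ?thesis by (rule off[OF False, of "{h * h}"])
          (use bb wR multR R(2) in \<open>auto simp: b_def\<close>)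
    next
      case True
      have "infinite (w ` {3..})"
        using winj by (simp add: finite_image_iff inj_on_subset[OF _ subset_UNIV] infinite_Ici)
      then show ?thesis
      proof (rule off[of _ "insert h (b ` {3..})"])
        show "u * v \<in> insert h (b ` {3..})" if uv: "u \<in> w ` {3..}" "v \<in> w ` {3..}" "u \<noteq> v" for u v
        proof -
          obtain i j where ij: "u = w i" "v = w j" "3 \<le> i" "3 \<le> j" using uv by auto
          show ?thesis using uv(3) ij dn[of j i] up[of i j]
            by (cases i j rule: linorder_cases) auto
        qed
      qed (use True wR R(2) in auto)
    qed
  qed
qed

section \<open>Semigroups with finite principal left ideals\<close>

text \<open>For a suitable sequence \<open>a\<close>, the element \<open>r i n\<close> is the product of any \<open>n\<close> members of \<open>a\<close> with
  index above \<open>i\<close>, followed by \<open>a i\<close>.\<close>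

lemma decreasing_product_sequence:
  assumes R: "subsemigroup R" "infinite R" and fin: "\<And>x. x \<in> R \<Longrightarrow> finite ((\<lambda>y. y * x) ` R)"
  obtains r :: "nat \<Rightarrow> nat \<Rightarrow> 'a::semigroup_mult"
  where "inj (\<lambda>i. r i 0)" "\<And>i n. r i n \<in> R" "\<And>i. finite (range (r i))"
    "\<And>i j m n. i < j \<Longrightarrow> r j m * r i n = r i (m + n + 1)"
    "\<And>i j m n k. r i m = r j n \<Longrightarrow> r i (m + k) = r j (n + k)"
proof -
  note ma = mult.assoc
  have multR: "u * v \<in> R" if "u \<in> R" "v \<in> R" for u v using R that by (auto simp: subsemigroup_def)
  obtain a0 :: "nat \<Rightarrow> 'a" where a0: "inj a0" "range a0 \<subseteq> R"
    using infinite_countable_subset[OF R(2)] by blast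
  define C where "C u = insert u ((\<lambda>y. y * u) ` R)" for u
  have CR: "C u \<subseteq> R" if "u \<in> R" for u using that multR by (auto simp: C_def)
  have Cfin: "finite (C u)" if "u \<in> R" for u using fin[OF that] by (simp add: C_def)
  \<comment> \<open>Row entries are whole functions: left translations by later members, restricted
    to the finite left ideal \<open>C (a0 i)\<close>. After thinning, all later members act on it
    alike.\<close>
  have "finite {restrict (\<lambda>x. a0 j * x) (C (a0 i)) | j. i < j}" for i
  proof (rule finite_subset)
    have ai: "a0 i \<in> R" using a0 by auto
    define B where "B = (\<Union>x\<in>C (a0 i). (\<lambda>y. y * x) ` R)"
    have "finite B" unfolding B_def using Cfin[OF ai] CR[OF ai] fin by auto
    then show "finite (C (a0 i) \<rightarrow>\<^sub>E B)" using Cfin[OF ai] by (intro finite_PiE) auto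
    show "{restrict (\<lambda>x. a0 j * x) (C (a0 i)) | j. i < j} \<subseteq> C (a0 i) \<rightarrow>\<^sub>E B"
      using a0(2) by (fastforce simp: B_def)
  qed
  then obtain s :: "nat \<Rightarrow> nat" where s: "strict_mono s" "\<And>i j k. i < j \<Longrightarrow> i < k \<Longrightarrow>
      restrict (\<lambda>x. a0 (s j) * x) (C (a0 (s i))) = restrict (\<lambda>x. a0 (s k) * x) (C (a0 (s i)))"
    using thinning[of "\<lambda>i j. restrict (\<lambda>x. a0 j * x) (C (a0 i))"] by blast
  define a where "a i = a0 (s i)" for i
  have aR: "a i \<in> R" for i using a0 by (auto simp: a_def)
  have aC: "a j * x = a k * x" if "i < j" "i < k" "x \<in> C (a i)" for i j k x
    using fun_cong[OF s(2)[OF that(1,2)], of x] that(3) by (simp add: a_def)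
  define r where "r i n = ((*) (a (Suc i)) ^^ n) (a i)" for i n
  have r0: "r i 0 = a i" and rS: "r i (Suc n) = a (Suc i) * r i n" for i n by (simp_all add: r_def)
  have rC: "r i n \<in> C (a i)" for i n
  proof (induction n)
    case (Suc n)
    then show ?case using aR multR by (auto simp: rS C_def ma[symmetric])
  qed (simp add: r0 C_def)
  have ar: "a j * r i n = r i (Suc n)" if "i < j" for i j n
    using aC[OF that _ rC, of "Suc i" n] by (simp add: rS)
  show thesis
  proof
    show "inj (\<lambda>i. r i 0)"
      by (auto simp: r0 a_def inj_def inj_eq[OF a0(1)] strict_mono_eq[OF s(1)])
    show "r i n \<in> R" for i n using rC CR[OF aR] by blast
    show "finite (range (r i))" for i
      by (rule finite_subset[OF _ Cfin[OF aR[of i]]]) (use rC in auto)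
    \<comment> \<open>The left factor consists of \<open>m + 1\<close> members of \<open>a\<close>,
      all with index above \<open>i\<close>; hence the extra 1.\<close>
    show "r j m * r i n = r i (m + n + 1)" if "i < j" for i j m n
    proof (induction m)
      case 0
      then show ?case using ar[OF that] by (simp add: r0)
    next
      case (Suc m)
      have "r j (Suc m) * r i n = a (Suc j) * (r j m * r i n)" by (simp add: rS ma)
      then show ?case using ar[of i "Suc j"] that Suc by simp
    qed
    \<comment> \<open>A multiplier with index above both \<open>i\<close> and \<open>j\<close>
      advances both rows, so equal values have equal successors.\<close>
    show "r i (m + k) = r j (n + k)" if "r i m = r j n" for i j m n k
    proof (induction k)
      case (Suc k)
      have "r i (m + Suc k) = a (Suc (i + j)) * r i (m + k)" by (simp add: ar)
      also have "\<dots> = r j (n + Suc k)" by (simp add: Suc ar)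
      finally show ?case .
    qed (use that in simp)
  qed
qed

text \<open>Keep only the indices at which a value occurs for the first time.\<close>

lemma infinite_range_inj_subsequence:
  fixes f :: "nat \<Rightarrow> 'b"
  assumes "infinite (range f)"
  obtains t :: "nat \<Rightarrow> nat" where "strict_mono t" "inj (f \<circ> t)"
proof -
  define I where "I = {k. \<forall>j<k. f j \<noteq> f k}"
  have "f k \<in> f ` I" for k
  proof -
    define m where "m = (LEAST m. f m = f k)"
    have "f m = f k" unfolding m_def by (rule LeastI[of _ k]) simp
    moreover have "f j \<noteq> f k" if "j < m" for j
      using not_less_Least[of j "\<lambda>m. f m = f k"] that by (simp add: m_def)
    ultimately show ?thesis by (intro image_eqI[of _ _ m]) (auto simp: I_def)
  qed
  then have "range f \<subseteq> f ` I" by blast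
  with assms have "infinite I" using finite_subset by blast
  then obtain t :: "nat \<Rightarrow> nat" where t: "strict_mono t" "\<And>n. t n \<in> I"
    using infinite_enumerate by blast
  have "f (t i) \<noteq> f (t j)" if "i < j" for i j
    using t(2)[of j] strict_monoD[OF t(1) that] by (auto simp: I_def)
  then have "inj (f \<circ> t)" by (intro injI) (metis comp_apply linorder_neqE_nat)
  with t(1) show thesis by (rule that)
qed

text \<open>Every row \<open>r i\<close> is eventually cyclic; \<open>P\<close> collects the values
  on the cycles. If \<open>P\<close> is infinite, idempotent powers of suitable cyclic values fix
  earlier values from the left, which leads to right absorbing idempotents. If \<open>P\<close> is
  finite, rows are chosen whose decreasing products fall into a finite set.\<close>

lemma contains_fs_if_finite_left_ideals:
  fixes R :: "'a::semigroup_mult set"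
  assumes R: "subsemigroup R" "infinite R" "\<And>x. x \<in> R \<Longrightarrow> periodic x"
    and fin: "\<And>x. x \<in> R \<Longrightarrow> finite ((\<lambda>y. y * x) ` R)"
  shows "contains_fs R"
proof -
  note ma = mult.assoc
  obtain r :: "nat \<Rightarrow> nat \<Rightarrow> 'a" where r0: "inj (\<lambda>i. r i 0)" and rR: "\<And>i n. r i n \<in> R"
    and rfin: "\<And>i. finite (range (r i))"
    and rr: "\<And>i j m n. i < j \<Longrightarrow> r j m * r i n = r i (m + n + 1)"
    and rdet: "\<And>i j m n k. r i m = r j n \<Longrightarrow> r i (m + k) = r j (n + k)"
    by (rule decreasing_product_sequence[OF R(1,2) fin]) (assumption, rule that)
  define rec where "rec i n \<longleftrightarrow> (\<exists>d>0. r i (n + d) = r i n)" for i n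
  define P where "P = {r i n | i n. rec i n}"
  have ev: "\<exists>N. \<forall>m\<ge>N. r i m \<in> P" for i
  proof -
    have "\<not> inj (r i)" using rfin[of i] finite_imageD[of "r i" UNIV] by auto
    then obtain m n where mn: "m < n" "r i m = r i n" by (metis injI linorder_neqE_nat)
    have "rec i k" if "m \<le> k" for k
      using rdet[OF mn(2)[symmetric], of "k - m"] mn(1) that
      by (auto simp: rec_def add.commute intro!: exI[of _ "n - m"])
    then show ?thesis by (auto simp: P_def)
  qed
  have finU: "finite (\<Union>j\<le>N. range (r j))" for N using rfin by simp
  \<comment> \<open>Each chosen value avoids every row up to the current one. This forces a strictly
    larger row and keeps the values distinct.\<close>
  have seq: "\<exists>(i :: nat \<Rightarrow> nat) (n :: nat \<Rightarrow> nat). strict_mono i \<and> inj (\<lambda>k. r (i k) (n k)) \<and> (\<forall>k. \<Phi> (i k) (n k)) \<and>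
      (\<forall>k l. k < l \<longrightarrow> \<Psi> (i k) (n l))"
    if step: "\<And>N. \<exists>i n. r i n \<notin> (\<Union>j\<le>N. range (r j)) \<and> \<Phi> i n \<and> (\<forall>j\<le>N. \<Psi> j n)"
    for \<Phi> \<Psi> :: "nat \<Rightarrow> nat \<Rightarrow> bool"
  proof -
    have "\<exists>f. \<forall>k. \<Phi> (fst (f k)) (snd (f k)) \<and>
      (r (fst (f (Suc k))) (snd (f (Suc k))) \<notin> (\<Union>j\<le>fst (f k). range (r j)) \<and>
      (\<forall>j\<le>fst (f k). \<Psi> j (snd (f (Suc k)))))"
    proof (rule dependent_nat_choice)
      show "\<exists>p. \<Phi> (fst p) (snd p)" using step[of 0] by (metis fst_conv snd_conv)
      show "\<exists>q. \<Phi> (fst q) (snd q) \<and> r (fst q) (snd q) \<notin> (\<Union>j\<le>fst p. range (r j)) \<and>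
        (\<forall>j\<le>fst p. \<Psi> j (snd q))" for p :: "nat \<times> nat"
      proof -
        obtain i n where "r i n \<notin> (\<Union>j\<le>fst p. range (r j)) \<and> \<Phi> i n \<and> (\<forall>j\<le>fst p. \<Psi> j n)"
          using step[of "fst p"] by (elim exE)
        then show ?thesis by (intro exI[of _ "(i, n)"]) simp
      qed
    qed
    then obtain f where f: "\<And>k. \<Phi> (fst (f k)) (snd (f k))"
      "\<And>k. r (fst (f (Suc k))) (snd (f (Suc k))) \<notin> (\<Union>j\<le>fst (f k). range (r j))"
      "\<And>k j. j \<le> fst (f k) \<Longrightarrow> \<Psi> j (snd (f (Suc k)))" by metis
    define i where "i = fst \<circ> f"
    define n where "n = snd \<circ> f"
    have "i k < i (Suc k)" for k
      using f(2)[of k]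
      by (rule contrapos_np) (auto simp: i_def intro!: bexI[of _ "fst (f (Suc k))"])
    then have i: "strict_mono i" by (simp add: strict_mono_Suc_iff)
    have *: "r (i k) (n k) \<noteq> r (i l) (n l)" "\<Psi> (i k) (n l)" if "k < l" for k l
    proof -
      obtain m where m: "l = Suc m" "k \<le> m" using \<open>k < l\<close> by (cases l) auto
      have le: "i k \<le> i m" using i m(2) by (simp add: strict_mono_less_eq)
      show "\<Psi> (i k) (n l)" using f(3)[of "i k" m] le by (simp add: i_def n_def m)
      show "r (i k) (n k) \<noteq> r (i l) (n l)"
      proof
        assume "r (i k) (n k) = r (i l) (n l)"
        then have "r (i l) (n l) \<in> range (r (i k))" by (metis rangeI)
        then show False using f(2)[of m] le by (auto simp: i_def n_def m)
      qed
    qed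
    have inj: "inj (\<lambda>k. r (i k) (n k))"
      by (intro injI) (metis *(1) linorder_neqE_nat)
    have \<Phi>: "\<Phi> (i k) (n k)" for k using f(1) by (simp add: i_def n_def)
    show ?thesis
      by (rule exI[of _ i], rule exI[of _ n]) (use i inj \<Phi> *(2) in blast)
  qed
  show ?thesis
  proof (cases "finite P")
    case False
    have "\<exists>i n. r i n \<notin> (\<Union>j\<le>N. range (r j)) \<and> rec i n \<and> (\<forall>j\<le>N. True)" for N
    proof -
      have "\<not> P \<subseteq> (\<Union>j\<le>N. range (r j))" using False finU finite_subset by blast
      then obtain v where "v \<in> P" "v \<notin> (\<Union>j\<le>N. range (r j))" by blast
      moreover then obtain i n where "v = r i n" "rec i n" by (auto simp: P_def)
      ultimately show ?thesis by blast
    qed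
    from seq[OF this] obtain i n :: "nat \<Rightarrow> nat" where
      "strict_mono i \<and> inj (\<lambda>k. r (i k) (n k)) \<and> (\<forall>k. rec (i k) (n k)) \<and> (\<forall>(k::nat) l. k < l \<longrightarrow> True)"
      by (elim exE) (rule that)
    then have i: "strict_mono i" and yinj: "inj (\<lambda>k. r (i k) (n k))"
      and rec: "\<And>k. rec (i k) (n k)" by blast+
    define y where "y k = r (i k) (n k)" for k
    have yR: "y k \<in> R" for k by (simp add: y_def rR)
    \<comment> \<open>Each left factor \<open>y l\<close> moves \<open>n l + 1\<close> steps along
      row \<open>i k\<close>.\<close>
    have spy: "spow (y l) m * y k = r (i k) (n k + (m + 1) * (n l + 1))" if "k < l" for k l m
    proof (induction m)
      case 0
      show ?case using rr[OF strict_monoD[OF i that]] by (simp add: y_def algebra_simps)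
    next
      case (Suc m)
      have "spow (y l) (Suc m) * y k = y l * (spow (y l) m * y k)" by (simp add: ma)
      then show ?case using rr[OF strict_monoD[OF i that]] Suc by (simp add: y_def algebra_simps)
    qed
    have "\<exists>d>0. r (i k) (n k + d) = r (i k) (n k)" for k using rec by (simp add: rec_def)
    then obtain d where d: "\<And>k. d k > 0" "\<And>k. r (i k) (n k + d k) = r (i k) (n k)" by metis
    have dt: "r (i k) (n k + d k * t) = y k" for k t
    proof (induction t)
      case (Suc t)
      then show ?case using rdet[OF d(2)[of k], of "d k * t"] by (simp add: algebra_simps)
    qed (simp add: y_def)
    have "\<exists>K. spow (y k) K * spow (y k) K = spow (y k) K" for k
      using periodic_idempotent_power[OF R(3)[OF yR]] by metis
    then obtain K where K: "\<And>k. spow (y k) (K k) * spow (y k) (K k) = spow (y k) (K k)" by metis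
    define f where "f k = spow (y k) (K k)" for k
    have fR: "f k \<in> R" for k by (simp add: f_def spow_in[OF R(1) yR])
    have ff: "f k * f k = f k" for k by (simp add: f_def K)
    have fy: "f l * y k = y k" if "k < l" for k l
    proof -
      \<comment> \<open>Being idempotent, \<open>f l\<close> equals its own power with exponent
        \<open>d k = c + 1\<close>. So it moves along row \<open>i k\<close> by a multiple of the
        period \<open>d k\<close> and fixes \<open>y k\<close>.\<close>
      obtain c where c: "d k = Suc c" using d(1)[of k] by (cases "d k") auto
      have "f l = spow (y l) (K l * c + K l + c)"
        using spow_idem[OF ff[of l], of c] by (simp add: f_def spow_spow)
      then have "f l * y k = r (i k) (n k + (K l * c + K l + c + 1) * (n l + 1))"
        using spy[OF that] by simp
      also have "(K l * c + K l + c + 1) * (n l + 1) = d k * ((K l + 1) * (n l + 1))"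
        by (simp add: c algebra_simps)
      finally show ?thesis by (simp only: dt)
    qed
    have fs: "f l * spow (y k) j = spow (y k) j" if "k < l" for k l j
      by (cases j) (use fy[OF that] in \<open>auto simp: ma[symmetric]\<close>)
    have ffk: "f l * f k = f k" if "k < l" for k l using fs[OF that] by (simp add: f_def[of k])
    have "infinite (range f)"
    proof
      assume "finite (range f)"
      then obtain k0 where k0: "infinite {k \<in> UNIV. f k = f k0}"
        using pigeonhole_infinite[of UNIV f] by auto
      \<comment> \<open>If \<open>f\<close> repeats, \<open>f k\<close> fixes \<open>y k\<close>
        from the left; as a power of \<open>y k\<close> it does so from the right too. Infinitely
        many \<open>y k\<close> would then lie in one finite left ideal.\<close>
      have "y k \<in> (\<lambda>u. u * f k0) ` R" if k: "f k = f k0" for k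
      proof -
        obtain l where l: "l > k" "f l = f k0" using k0 by (auto simp: infinite_nat_iff_unbounded)
        have "y k * f k0 = f k0 * y k" using mult_spow_commute[of "y k" "K k"] k by (simp add: f_def)
        also have "\<dots> = y k" using fy[OF l(1)] by (simp add: l)
        finally show ?thesis using yR by (metis imageI)
      qed
      then have "y ` {k \<in> UNIV. f k = f k0} \<subseteq> (\<lambda>u. u * f k0) ` R" by blast
      then have "finite (y ` {k \<in> UNIV. f k = f k0})" using fin[OF fR] finite_subset by blast
      moreover have "inj_on y {k \<in> UNIV. f k = f k0}" using yinj by (simp add: inj_on_def y_def)
      ultimately show False using k0 finite_imageD by blast
    qed
    then obtain t :: "nat \<Rightarrow> nat" where t: "strict_mono t" "inj (f \<circ> t)"
      using infinite_range_inj_subsequence by blast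
    show ?thesis
      by (rule contains_fs_if_right_absorbing_idempotents[OF R(1) t(2)])
        (use fR ff ffk strict_monoD[OF t(1)] in auto)
  next
    case True
    have dec: "contains_fs R" if "inj x" "\<And>i. x i \<in> R" "finite H"
      "\<And>i j. i < j \<Longrightarrow> x j * x i \<in> H" for x :: "nat \<Rightarrow> 'a" and H
      by (rule contains_fs_if_finite_decreasing_products[OF R(1,3) that])
    show ?thesis
    proof (cases "\<forall>n. infinite (range (\<lambda>i. r i n))")
      case True
      \<comment> \<open>The column \<open>n\<close> lies past the point from which all rows up to
        \<open>N\<close> stay in \<open>P\<close>; a product of a later choice with an earlier one
        then lands in \<open>P\<close>.\<close>
      have "\<exists>i n. r i n \<notin> (\<Union>j\<le>N. range (r j)) \<and> True \<and> (\<forall>j\<le>N. \<forall>m\<ge>n. r j m \<in> P)" for N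
      proof -
        obtain M where M: "\<And>j m. m \<ge> M j \<Longrightarrow> r j m \<in> P" using ev by metis
        define n where "n = (\<Sum>j\<le>N. M j)"
        have "M j \<le> n" if "j \<le> N" for j
          unfolding n_def using that by (intro member_le_sum) auto
        moreover have "\<not> range (\<lambda>i. r i n) \<subseteq> (\<Union>j\<le>N. range (r j))"
          using True finU finite_subset by blast
        then obtain i where "r i n \<notin> (\<Union>j\<le>N. range (r j))" by blast
        ultimately show ?thesis using M by (meson order_trans)
      qed
      from seq[OF this] obtain i n :: "nat \<Rightarrow> nat" where
        "strict_mono i \<and> inj (\<lambda>k. r (i k) (n k)) \<and> (\<forall>k::nat. True) \<and>
          (\<forall>k l. k < l \<longrightarrow> (\<forall>m\<ge>n l. r (i k) m \<in> P))"
        by (elim exE) (rule that)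
      then have i: "strict_mono i" and inj: "inj (\<lambda>k. r (i k) (n k))"
        and P: "\<And>k l m. k < l \<Longrightarrow> m \<ge> n l \<Longrightarrow> r (i k) m \<in> P" by blast+
      show ?thesis
        by (rule dec[OF inj rR \<open>finite P\<close>]) (simp_all add: rr strict_monoD[OF i] P)
    next
      case False
      \<comment> \<open>Column 0 is injective, so the first finite column has an infinite
        predecessor \<open>m\<close>. Decreasing products of entries of column \<open>m\<close> lie
        in column \<open>m + m + 1 = n + m\<close>.\<close>
      define n where "n = (LEAST n. finite (range (\<lambda>i. r i n)))"
      have n: "finite (range (\<lambda>i. r i n))" unfolding n_def using False by (metis (mono_tags) LeastI)
      have "n \<noteq> 0" using n r0 finite_imageD[of "\<lambda>i. r i 0" UNIV] by (auto intro: ccontr)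
      then obtain m where m: "n = Suc m" using not0_implies_Suc by blast
      have "infinite (range (\<lambda>i. r i m))"
        using not_less_Least[of m "\<lambda>n. finite (range (\<lambda>i. r i n))"] m by (simp add: n_def)
      then obtain t :: "nat \<Rightarrow> nat" where t: "strict_mono t" "inj ((\<lambda>i. r i m) \<circ> t)"
        using infinite_range_inj_subsequence by blast
      define H where "H = range (\<lambda>i. r i (n + m))"
      \<comment> \<open>Column \<open>n + m\<close> is finite because each entry is determined by
        the entry of its row in the finite column \<open>n\<close>.\<close>
      have "r i (n + m) \<in> (\<lambda>v. r (SOME i. r i n = v) (n + m)) ` range (\<lambda>i. r i n)" for i
      proof (intro image_eqI[of _ _ "r i n"] rdet)
        show "r i n = r (SOME i'. r i' n = r i n) n" by (rule someI2[of _ i]) auto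
      qed auto
      then have "H \<subseteq> (\<lambda>v. r (SOME i. r i n = v) (n + m)) ` range (\<lambda>i. r i n)" by (auto simp: H_def)
      then have "finite H" using n finite_subset by blast
      then show ?thesis
      proof (rule dec[OF t(2) _ , rotated])
        show "((\<lambda>i. r i m) \<circ> t) l * ((\<lambda>i. r i m) \<circ> t) k \<in> H" if "k < l" for k l
          using rr[OF strict_monoD[OF t(1) that], of m m] by (auto simp: H_def m)
      qed (simp add: rR)
    qed
  qed
qed

text \<open>The opposite semigroup, for left-right duality.\<close>

datatype 'a opp = Opp (unopp: 'a)

instantiation opp :: (semigroup_mult) semigroup_mult
begin
definition times_opp_def: "a * b = Opp (unopp b * unopp a)"
instance by standard (simp add: times_opp_def mult.assoc)
end

lemma Opp_mult: "Opp a * Opp b = Opp (b * a)"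
  by (simp add: times_opp_def)

lemma inj_Opp: "inj_on Opp A"
  by (simp add: inj_on_def)

lemma spow_Opp: "spow (Opp x) n = Opp (spow x n)"
  by (induction n) (simp_all add: Opp_mult mult_spow_commute)

lemma periodic_Opp: "periodic (Opp x) \<longleftrightarrow> periodic x"
proof -
  have "range (spow (Opp x)) = Opp ` range (spow x)" by (auto simp: spow_Opp)
  then show ?thesis by (simp add: periodic_def finite_image_iff[OF inj_Opp])
qed

lemma subsemigroup_Opp: "subsemigroup (Opp ` R) \<longleftrightarrow> subsemigroup R"
  by (auto simp: subsemigroup_def Opp_mult)

lemma contains_fs_Opp:
  assumes "contains_fs (Opp ` R)"
  shows "contains_fs R"
proof -
  obtain T where T: "T \<subseteq> Opp ` R" "subsemigroup T" "infinite T" "finitely_synchronizing T"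
    using assms by (auto simp: contains_fs_def)
  then obtain T' where T': "T' \<subseteq> R" "T = Opp ` T'" by (auto simp: subset_image_iff)
  obtain F where F: "finite F" "F \<subseteq> T" "\<And>a b. a \<in> T \<Longrightarrow> b \<in> T \<Longrightarrow> a * b \<in> {a, b} \<union> F"
    using T(4) by (auto simp: finitely_synchronizing_def)
  obtain F' where F': "F' \<subseteq> T'" "F = Opp ` F'" using F(2) T'(2) by (auto simp: subset_image_iff)
  have "finite F'" using F(1) F'(2) finite_image_iff[OF inj_Opp] by blast
  moreover have "a * b \<in> {a, b} \<union> F'" if "a \<in> T'" "b \<in> T'" for a b
    using F(3)[of "Opp b" "Opp a"] that by (auto simp: T' F' Opp_mult)
  ultimately have "finitely_synchronizing T'"
    unfolding finitely_synchronizing_def using F'(1) by blast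
  moreover have "infinite T'" using T(3) T'(2) by blast
  moreover have "subsemigroup T'" using T(2) by (simp add: T' subsemigroup_Opp)
  ultimately show ?thesis using T'(1) by (auto simp: contains_fs_def)
qed

section \<open>Periodic semigroups: Shevrin's theorem\<close>

text \<open>If \<open>x R\<close> were infinite, infinitely many \<open>u\<close> in it would share
  the value \<open>u * x\<close>. As they lie in \<open>x R\<close>, any two satisfy
  \<open>u * v = v * v\<close>, so multiplying by a power of \<open>v\<close> on the right always
  gives a power of \<open>v\<close>. The set of all their powers thus has finite principal left
  ideals.\<close>

lemma finite_sandwich_imp_finite_right_ideal:
  fixes R :: "'a::semigroup_mult set"
  assumes R: "subsemigroup R" "\<And>x. x \<in> R \<Longrightarrow> periodic x" "\<not> contains_fs R"
    and x: "x \<in> R" "finite ((\<lambda>r. x * r * x) ` R)"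
  shows "finite ((*) x ` R)"
proof (rule ccontr)
  note ma = mult.assoc
  have multR: "u * v \<in> R" if "u \<in> R" "v \<in> R" for u v using R that by (auto simp: subsemigroup_def)
  assume inf: "infinite ((*) x ` R)"
  have "finite ((\<lambda>u. u * x) ` (*) x ` R)" using x(2) by (simp add: image_image)
  then obtain u0 where u0: "infinite {u \<in> (*) x ` R. u * x = u0 * x}"
    using pigeonhole_infinite[OF inf] by blast
  define U where "U = {u \<in> (*) x ` R. u * x = u0 * x}"
  have UR: "U \<subseteq> R" using x multR by (auto simp: U_def)
  have uv: "u * v = v * v" if "u \<in> U" "v \<in> U" for u v
  proof -
    obtain b where "v = x * b" using \<open>v \<in> U\<close> by (auto simp: U_def)
    then show ?thesis using that by (simp add: U_def ma[symmetric])
  qed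
  have us: "u * spow v n = spow v (Suc n)" if "u \<in> U" "v \<in> U" for u v n
    by (cases n) (simp_all add: uv[OF that] ma[symmetric])
  have ss: "spow u m * spow v n = spow v (m + n + 1)" if "u \<in> U" "v \<in> U" for u v m n
  proof (induction m)
    case (Suc m)
    have "spow u (Suc m) * spow v n = u * (spow u m * spow v n)" by (simp add: ma)
    then show ?case by (simp only: Suc us[OF that]) simp
  qed (simp add: us[OF that] del: spow.simps(2))
  define X where "X = {spow v n | v n. v \<in> U}"
  have XR: "X \<subseteq> R" using UR spow_in[OF R(1)] by (auto simp: X_def)
  have UX: "U \<subseteq> X" unfolding X_def by (metis (mono_tags, lifting) mem_Collect_eq spow.simps(1) subsetI)
  have "contains_fs X"
  proof (rule contains_fs_if_finite_left_ideals)
    show "infinite X" using u0 UX finite_subset by (auto simp: U_def)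
    then have "X \<noteq> {}" by auto
    then show "subsemigroup X" unfolding subsemigroup_def X_def using ss by blast
    show "periodic y" if "y \<in> X" for y using that XR R(2) by blast
    show "finite ((\<lambda>y. y * w) ` X)" if "w \<in> X" for w
    proof -
      obtain v n where w: "w = spow v n" "v \<in> U" using \<open>w \<in> X\<close> by (auto simp: X_def)
      have "(\<lambda>y. y * w) ` X \<subseteq> range (spow v)" using ss w by (auto simp: X_def simp del: spow.simps)
      moreover have "finite (range (spow v))" using R(2) UR w(2) by (auto simp: periodic_def)
      ultimately show ?thesis using finite_subset by blast
    qed
  qed
  with XR R(3) show False using contains_fs_mono by blast
qed

text \<open>The sandwich hypothesis is self-dual, so the previous result applies in the opposite
  semigroup.\<close>

lemma finite_sandwich_imp_finite_left_ideal:
  fixes R :: "'a::semigroup_mult set"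
  assumes R: "subsemigroup R" "\<And>x. x \<in> R \<Longrightarrow> periodic x" "\<not> contains_fs R"
    and x: "x \<in> R" "finite ((\<lambda>r. x * r * x) ` R)"
  shows "finite ((\<lambda>r. r * x) ` R)"
proof -
  have "(\<lambda>r. Opp x * r * Opp x) ` Opp ` R = Opp ` (\<lambda>r. x * r * x) ` R"
    by (simp add: image_image Opp_mult mult.assoc)
  then have "finite ((\<lambda>r. Opp x * r * Opp x) ` Opp ` R)" using x(2) by simp
  then have "finite ((*) (Opp x) ` Opp ` R)"
    using R x contains_fs_Opp by (intro finite_sandwich_imp_finite_right_ideal)
      (auto simp: subsemigroup_Opp periodic_Opp)
  also have "(*) (Opp x) ` Opp ` R = Opp ` (\<lambda>r. r * x) ` R" by (simp add: image_image Opp_mult)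
  finally show ?thesis by (simp add: finite_image_iff[OF inj_Opp])
qed

text \<open>The exponent is lowered one step at a time. With \<open>y\<close> the next lower power,
  \<open>y * y\<close> generates finite one-sided ideals, so \<open>R (y * y) R\<close> is finite
  and contains the middle part of any product of two elements of \<open>y R y\<close>.\<close>

lemma finite_sandwich_of_power:
  fixes R :: "'a::semigroup_mult set"
  assumes R: "subsemigroup R" "\<And>x. x \<in> R \<Longrightarrow> periodic x" "\<not> contains_fs R"
    and x: "x \<in> R" "finite ((\<lambda>r. spow x k * r * spow x k) ` R)"
  shows "finite ((\<lambda>r. x * r * x) ` R)"
proof -
  note ma = mult.assoc
  have multR: "u * v \<in> R" if "u \<in> R" "v \<in> R" for u v using R that by (auto simp: subsemigroup_def)
  have step: "finite ((\<lambda>r. spow x j * r * spow x j) ` R)"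
    if fin: "finite ((\<lambda>r. spow x (Suc j) * r * spow x (Suc j)) ` R)" for j
  proof (rule ccontr)
    define y where "y = spow x j"
    have yR: "y \<in> R" by (simp add: y_def spow_in R(1) x(1))
    assume "infinite ((\<lambda>r. spow x j * r * spow x j) ` R)"
    then have inf: "infinite ((\<lambda>r. y * r * y) ` R)" by (simp add: y_def)
    \<comment> \<open>The true exponent of \<open>y * y\<close> is \<open>2 * j + 2\<close>, at
      least the \<open>j + 2\<close> of the hypothesis; any surplus power moves into the middle
      factor.\<close>
    have "finite ((\<lambda>r. (y * y) * r * (y * y)) ` R)"
    proof (cases j)
      case 0
      then show ?thesis using fin by (simp add: y_def)
    next
      case (Suc i)
      define w where "w = spow x (Suc j)"
      define s where "s = spow x i"
      have yw: "y * y = w * s" "y * y = s * w"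
        unfolding y_def w_def s_def by (simp_all only: spow_mult Suc) simp_all
      have "(\<lambda>r. (y * y) * r * (y * y)) ` R \<subseteq> (\<lambda>r. w * r * w) ` R"
      proof (rule image_subsetI)
        fix r assume "r \<in> R"
        have "(y * y) * r * (y * y) = (w * s) * r * (s * w)" using yw by simp
        also have "\<dots> = w * (s * r * s) * w" by (simp only: ma)
        finally show "(y * y) * r * (y * y) \<in> (\<lambda>r. w * r * w) ` R"
          using \<open>r \<in> R\<close> multR spow_in[OF R(1) x(1)] by (auto simp: s_def)
      qed
      then show ?thesis using fin finite_subset by (auto simp: w_def)
    qed
    then have fr: "finite ((*) (y * y) ` R)" and fl: "finite ((\<lambda>r. r * (y * y)) ` R)"
      using finite_sandwich_imp_finite_right_ideal[OF R, of "y * y"]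
        finite_sandwich_imp_finite_left_ideal[OF R, of "y * y"] multR[OF yR yR] by auto
    define C where "C = (\<lambda>r. r * (y * y)) ` R"
    define H where "H = (\<lambda>u. y * u * y) ` (\<Union>c\<in>C. (*) c ` R)"
    have "finite ((*) c ` R)" if "c \<in> C" for c
    proof -
      obtain r where "c = r * (y * y)" using \<open>c \<in> C\<close> by (auto simp: C_def)
      then have "(*) c ` R = (*) r ` (*) (y * y) ` R" by (simp add: image_image ma)
      then show ?thesis using fr by simp
    qed
    moreover have "finite C" using fl by (simp add: C_def)
    ultimately have "finite H" by (simp add: H_def)
    moreover have "a * b \<in> H" if ab: "a \<in> (\<lambda>r. y * r * y) ` R" "b \<in> (\<lambda>r. y * r * y) ` R" for a b
    proof -
      obtain r s where rs: "r \<in> R" "s \<in> R" "a = y * r * y" "b = y * s * y" using ab by auto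
      have "a * b = y * ((r * (y * y)) * s) * y" by (simp add: rs ma)
      then show ?thesis using rs by (auto simp: H_def C_def)
    qed
    moreover have "(\<lambda>r. y * r * y) ` R \<subseteq> R" using multR yR by auto
    ultimately have "contains_fs R"
      using R(2) by (intro contains_fs_if_finite_offdiagonal[OF R(1) inf]) auto
    with R(3) show False by blast
  qed
  show ?thesis using x(2)
  proof (induction k)
    case (Suc k)
    then show ?case using step by blast
  qed simp
qed

text \<open>Each \<open>x\<close> has an idempotent power \<open>e\<close>. Finiteness passes from
  \<open>e R e\<close> to \<open>x R x\<close> and then to \<open>R x\<close>, and finite left
  ideals would give a finitely synchronizing subsemigroup.\<close>

lemma infinite_local_monoid_exists:
  fixes R :: "'a::semigroup_mult set"
  assumes R: "subsemigroup R" "\<And>x. x \<in> R \<Longrightarrow> periodic x" "\<not> contains_fs R" "infinite R"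
  shows "\<exists>e\<in>R. e * e = e \<and> infinite ((\<lambda>r. e * r * e) ` R)"
proof (rule ccontr)
  assume no: "\<not> ?thesis"
  have "finite ((\<lambda>r. r * x) ` R)" if "x \<in> R" for x
  proof -
    obtain k where "spow x k * spow x k = spow x k"
      using periodic_idempotent_power[OF R(2)[OF \<open>x \<in> R\<close>]] by blast
    then have "finite ((\<lambda>r. spow x k * r * spow x k) ` R)"
      using no spow_in[OF R(1) that] by blast
    then show ?thesis
      using finite_sandwich_of_power[OF R(1-3) that] finite_sandwich_imp_finite_left_ideal[OF R(1-3) that]
      by blast
  qed
  then show False using contains_fs_if_finite_left_ideals[OF R(1,4,2)] R(3) by blast
qed

text \<open>The identity is a parameter since any idempotent of the ambient semigroup may
  serve.\<close>

definition is_subgroup :: "'a::semigroup_mult set \<Rightarrow> 'a \<Rightarrow> bool" where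
  "is_subgroup G e \<longleftrightarrow> e \<in> G \<and> (\<forall>x\<in>G. \<forall>y\<in>G. x * y \<in> G) \<and>
     (\<forall>x\<in>G. e * x = x \<and> x * e = x \<and> (\<exists>y\<in>G. x * y = e \<and> y * x = e))"

text \<open>From \<open>x * u = e\<close> every power of \<open>x\<close> has a right inverse, and
  an idempotent with a right inverse is \<open>e\<close>. So some power of \<open>x\<close> is
  \<open>e\<close>.\<close>

lemma periodic_right_invertible_imp_invertible:
  assumes M: "subsemigroup M" "\<And>x. x \<in> M \<Longrightarrow> e * x = x \<and> x * e = x" "e \<in> M"
    and x: "x \<in> M" "periodic x" "u \<in> M" "x * u = e"
  shows "\<exists>y\<in>M. x * y = e \<and> y * x = e"
proof -
  note ma = mult.assoc
  obtain k where k: "spow x k * spow x k = spow x k" using periodic_idempotent_power[OF x(2)] .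
  have xu: "spow x n * spow u n = e" for n
  proof (induction n)
    case (Suc n)
    have "spow x (Suc n) * spow u (Suc n) = (spow x n * (x * u)) * spow u n"
      by (simp add: mult_spow_commute ma)
    then show ?case using Suc x(4) M(2)[OF spow_in[OF M(1) x(1)]] by simp
  qed (simp add: x)
  then have "spow x k = spow x k * (spow x k * spow u k)"
    using M(2)[OF spow_in[OF M(1) x(1)]] by simp
  also have "\<dots> = e" by (metis k xu ma)
  finally have e: "spow x k = e" .
  \<comment> \<open>The inverse is read off from the square of \<open>spow x k\<close>: for
    \<open>k = 0\<close> that power has no predecessor, but its square has.\<close>
  have "x * spow x (2 * k) = spow x k * spow x k" by (simp add: spow_mult mult_2)
  then have "x * spow x (2 * k) = e" using M(2)[OF M(3)] by (simp add: e)
  then show ?thesis using spow_in[OF M(1) x(1)] by (auto simp: mult_spow_commute[symmetric])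
qed

text \<open>The nonunits of \<open>e R e\<close> are taken. They are closed under products: if
  \<open>x * y\<close> were a unit, \<open>x\<close> would be right invertible, hence a unit by
  periodicity. They are infinite because the group of units is finite.\<close>

lemma remove_units:
  fixes R :: "'a::semigroup_mult set"
  assumes R: "subsemigroup R" "\<And>x. x \<in> R \<Longrightarrow> periodic x"
    and e: "e \<in> R" "e * e = e" "infinite ((\<lambda>r. e * r * e) ` R)"
    and no: "\<And>G e. G \<subseteq> R \<Longrightarrow> is_subgroup G e \<Longrightarrow> finite G"
  shows "\<exists>R'\<subseteq>R. subsemigroup R' \<and> infinite R' \<and> (\<forall>x\<in>R'. e * x = x \<and> x * e = x \<and> x \<noteq> e)"
proof -
  note ma = mult.assoc
  have multR: "u * v \<in> R" if "u \<in> R" "v \<in> R" for u v using R that by (auto simp: subsemigroup_def)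
  define M where "M = (\<lambda>r. e * r * e) ` R"
  have MR: "M \<subseteq> R" using multR e by (auto simp: M_def)
  have Me: "e * x = x \<and> x * e = x" if "x \<in> M" for x
    using that e(2) by (auto simp: M_def ma) (simp_all add: ma[symmetric])
  have Mmem: "x \<in> M" if "x \<in> R" "e * x = x" "x * e = x" for x
    using that by (metis M_def image_eqI)
  have eM: "e \<in> M" using Mmem e by blast
  have Mmult: "x * y \<in> M" if "x \<in> M" "y \<in> M" for x y
  proof (rule Mmem)
    show "x * y \<in> R" using that MR multR by blast
    show "e * (x * y) = x * y" using Me[OF that(1)] by (simp add: ma[symmetric])
    show "x * y * e = x * y" using Me[OF that(2)] by (simp add: ma)
  qed
  have Msub: "subsemigroup M" unfolding subsemigroup_def using eM Mmult by blast
  define G where "G = {x \<in> M. \<exists>y\<in>M. x * y = e \<and> y * x = e}"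
  have "x * y \<in> G" if xy: "x \<in> G" "y \<in> G" for x y
  proof -
    obtain x' y' where i: "x' \<in> M" "y' \<in> M" "x * x' = e" "x' * x = e" "y * y' = e" "y' * y = e"
      using xy by (auto simp: G_def)
    have M: "x \<in> M" "y \<in> M" using xy by (auto simp: G_def)
    have "(x * y) * (y' * x') = x * ((y * y') * x')" "(y' * x') * (x * y) = y' * ((x' * x) * y)"
      by (simp_all only: ma)
    then have "(x * y) * (y' * x') = e" "(y' * x') * (x * y) = e" using i Me M by auto
    then show ?thesis using Mmult M i by (auto simp: G_def)
  qed
  moreover have "\<exists>y\<in>G. x * y = e \<and> y * x = e" if "x \<in> G" for x using that by (auto simp: G_def)
  moreover have "e \<in> G" using eM e(2) by (auto simp: G_def)
  ultimately have "is_subgroup G e" unfolding is_subgroup_def using Me by (auto simp: G_def)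
  then have "finite G" using no[of G e] MR by (auto simp: G_def)
  then have inf: "infinite (M - G)" using e(3) by (simp add: M_def)
  have "x * y \<in> M - G" if xy: "x \<in> M - G" "y \<in> M - G" for x y
  proof
    show "x * y \<in> M" using xy Mmult by blast
    show "x * y \<notin> G"
    proof
      assume "x * y \<in> G"
      then obtain u where u: "u \<in> M" "(x * y) * u = e" by (auto simp: G_def)
      have "x \<in> G" using periodic_right_invertible_imp_invertible[OF Msub Me eM, of x "y * u"] xy u R(2) MR Mmult
        by (auto simp: G_def ma)
      with xy show False by blast
    qed
  qed
  then have "subsemigroup (M - G)"
    unfolding subsemigroup_def using infinite_imp_nonempty[OF inf] by blast
  then show ?thesis using inf MR Me \<open>e \<in> G\<close> by (intro exI[of _ "M - G"]) auto
qed

text \<open>Without infinite subgroups the descent never stops. Any two idempotents of the resulting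
  chain multiply to the later one, so the chain is finitely synchronizing with empty exceptional
  set.\<close>

theorem shevrin:
  fixes T :: "'a::semigroup_mult set"
  assumes T: "subsemigroup T" "infinite T" "\<And>x. x \<in> T \<Longrightarrow> periodic x" "\<not> contains_fs T"
  obtains G e where "G \<subseteq> T" "infinite G" "is_subgroup G e"
proof (rule ccontr)
  assume "\<not> thesis"
  with that have no: "finite G" if "G \<subseteq> T" "is_subgroup G e" for G e using \<open>G \<subseteq> T\<close> \<open>is_subgroup G e\<close> by blast
  \<comment> \<open>A state is an infinite subsemigroup and an idempotent that acts on it as
    identity without belonging to it; the next idempotent is taken inside.\<close>
  define P where "P = (\<lambda>(n::nat) (p :: 'a set \<times> 'a). fst p \<subseteq> T \<and> subsemigroup (fst p) \<and> infinite (fst p) \<and>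
    snd p \<in> T \<and> snd p * snd p = snd p \<and>
    (\<forall>x\<in>fst p. snd p * x = x \<and> x * snd p = x \<and> x \<noteq> snd p))"
  define Q where "Q = (\<lambda>(n::nat) (p :: 'a set \<times> 'a) q. snd q \<in> fst p \<and> fst q \<subseteq> fst p)"
  have step: "\<exists>q. P n q \<and> snd q \<in> R \<and> fst q \<subseteq> R" if R: "R \<subseteq> T" "subsemigroup R" "infinite R" for R n
  proof -
    have per: "periodic x" if "x \<in> R" for x using that R(1) T(3) by blast
    have "\<not> contains_fs R" using T(4) R(1) contains_fs_mono by blast
    then obtain e where e: "e \<in> R" "e * e = e" "infinite ((\<lambda>r. e * r * e) ` R)"
      using infinite_local_monoid_exists[OF R(2) per] R(3) by blast
    obtain R' where "R' \<subseteq> R" "subsemigroup R'" "infinite R'"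
      "\<forall>x\<in>R'. e * x = x \<and> x * e = x \<and> x \<noteq> e"
      using remove_units[OF R(2) per e] no R(1) by (meson subset_trans)
    then show ?thesis using e R(1) by (intro exI[of _ "(R', e)"]) (auto simp: P_def)
  qed
  have "\<exists>f. \<forall>n. P n (f n) \<and> Q n (f n) (f (Suc n))"
  proof (rule dependent_nat_choice)
    show "\<exists>p. P 0 p" using step[OF subset_refl T(1,2)] by blast
    show "\<exists>q. P (Suc n) q \<and> Q n p q" if "P n p" for p n
      using step[of "fst p" "Suc n"] that by (auto simp: P_def Q_def)
  qed
  then obtain f where f: "\<And>n. P n (f n)" "\<And>n. Q n (f n) (f (Suc n))" by blast
  define e where "e n = snd (f n)" for n
  have sub: "fst (f j) \<subseteq> fst (f i)" if "i \<le> j" for i j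
    by (rule lift_Suc_antimono_le[OF _ that]) (use f(2) in \<open>auto simp: Q_def\<close>)
  have mem: "e j \<in> fst (f i)" if "i < j" for i j
  proof -
    obtain k where k: "j = Suc k" "i \<le> k" using \<open>i < j\<close> by (cases j) auto
    show ?thesis using f(2)[of k] sub[OF k(2)] by (auto simp: Q_def e_def k)
  qed
  have ee: "e i * e j = e j" "e j * e i = e j" "e i \<noteq> e j" if "i < j" for i j
    using f(1)[of i] mem[OF that] by (auto simp: P_def e_def)
  have e2: "e i * e i = e i" "e i \<in> T" for i using f(1)[of i] by (auto simp: P_def e_def)
  have "inj e" by (intro injI) (metis ee(3) linorder_neqE_nat)
  then have inf: "infinite (range e)" using finite_imageD infinite_UNIV_nat by blast
  have "contains_fs T"
  proof (rule contains_fsI[OF inf, of T "{}"])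
    show "u * v \<in> {u, v} \<union> {}" if uv: "u \<in> range e \<union> {}" "v \<in> range e \<union> {}" for u v
    proof -
      obtain i j where "u = e i" "v = e j" using uv by auto
      then show ?thesis using ee e2 by (cases i j rule: linorder_cases) auto
    qed
  qed (use e2 in auto)
  with T(4) show False by blast
qed

section \<open>A coloring without almost-monochromatic cyclic subsemigroups and groups\<close>

text \<open>In the graph of \<open>f\<close>, colors alternate along a component without odd cycles
  by parity of the distance to a representative. The parity condition is stated pointwise, since
  other components may contain odd cycles.\<close>

lemma alternating_coloring:
  fixes f :: "'a \<Rightarrow> 'a"
  shows "\<exists>c :: 'a \<Rightarrow> bool. \<forall>x. (\<forall>m n. (f ^^ m) x = (f ^^ n) x \<longrightarrow> even (m + n)) \<longrightarrow> c (f x) \<noteq> c x"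
proof -
  define rel where "rel x y \<longleftrightarrow> (\<exists>m n. (f ^^ m) x = (f ^^ n) y)" for x y
  have sym: "rel y x" if "rel x y" for x y using that unfolding rel_def by metis
  have trans: "rel x z" if xy: "rel x y" and yz: "rel y z" for x y z
  proof -
    obtain m n where 1: "(f ^^ m) x = (f ^^ n) y" using xy by (auto simp: rel_def)
    obtain p q where 2: "(f ^^ p) y = (f ^^ q) z" using yz by (auto simp: rel_def)
    have "(f ^^ (p + m)) x = (f ^^ (p + n)) y" by (simp add: funpow_add 1)
    also have "\<dots> = (f ^^ (n + q)) z" by (subst add.commute) (simp add: funpow_add 2)
    finally show ?thesis unfolding rel_def by blast
  qed
  define rep where "rep x = (SOME y. rel x y)" for x
  have rel_rep: "rel x (rep x)" for x
    unfolding rep_def by (rule someI[of _ x]) (auto simp: rel_def)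
  have rep_f: "rep (f x) = rep x" for x
  proof -
    have "rel (f x) x" unfolding rel_def by (rule exI[of _ 0], rule exI[of _ 1]) simp
    then have "rel (f x) = rel x" by (auto intro: sym trans)
    then show ?thesis by (simp add: rep_def)
  qed
  define c where "c x \<longleftrightarrow> (\<exists>m n. (f ^^ m) x = (f ^^ n) (rep x) \<and> even (m + n))" for x
  show ?thesis
  proof (intro exI[of _ c] allI impI)
    fix x assume par: "\<forall>m n. (f ^^ m) x = (f ^^ n) x \<longrightarrow> even (m + n)"
    define z where "z = rep x"
    have "\<not> (c x \<and> c (f x))"
    proof
      assume "c x \<and> c (f x)"
      then obtain m n p q where 1: "(f ^^ m) x = (f ^^ n) z" "even (m + n)"
        and 2: "(f ^^ p) (f x) = (f ^^ q) z" "even (p + q)"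
        unfolding c_def rep_f z_def by blast
      have "(f ^^ (q + m)) x = (f ^^ (q + n)) z" by (simp add: funpow_add 1)
      also have "\<dots> = (f ^^ (n + Suc p)) x"
        by (subst add.commute) (simp add: funpow_add 2 funpow_swap1)
      finally have "even (q + m + (n + Suc p))" using par by blast
      then show False using 1 2 by presburger
    qed
    moreover have "c x \<or> c (f x)"
    proof -
      obtain m n where mn: "(f ^^ m) x = (f ^^ n) z" using rel_rep[of x] by (auto simp: rel_def z_def)
      show ?thesis
      proof (cases "even (m + n)")
        case True
        then show ?thesis using mn by (auto simp: c_def z_def)
      next
        case False
        have "(f ^^ m) (f x) = (f ^^ Suc n) z" using arg_cong[OF mn, of f] by (simp add: funpow_swap1)
        moreover have "even (m + Suc n)" using False by simp
        ultimately show ?thesis unfolding c_def rep_f z_def by blast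
      qed
    qed
    ultimately show "c (f x) \<noteq> c x" by blast
  qed
qed

text \<open>The group inverse of semigroup theory. It mentions no identity and agrees with inversion
  in every subgroup, so one partial map serves all subgroups simultaneously.\<close>

definition group_inverse :: "'a::semigroup_mult \<Rightarrow> 'a \<Rightarrow> bool" where
  "group_inverse x y \<longleftrightarrow> x * y = y * x \<and> x * y * x = x \<and> y * x * y = y"

lemma group_inverse_sym: "group_inverse x y \<Longrightarrow> group_inverse y x"
  by (auto simp: group_inverse_def)

lemma group_inverse_unique:
  assumes "group_inverse x y" "group_inverse x z"
  shows "y = z"
proof -
  have y: "x * y = y * x" "x * y * x = x" "y * x * y = y"
    and z: "x * z = z * x" "x * z * x = x" "z * x * z = z"
    using assms by (auto simp: group_inverse_def)
  have "x * z = (x * y * x) * z" by (simp only: y(2))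
  also have "\<dots> = (x * y) * (x * z)" by (simp only: mult.assoc)
  also have "\<dots> = (y * x) * (z * x)" by (simp only: y(1) z(1))
  also have "\<dots> = y * (x * z * x)" by (simp only: mult.assoc)
  also have "\<dots> = x * y" by (simp only: y(1) z(2))
  finally have e: "x * z = x * y" .
  have "y = y * x * y" by (simp only: y(3))
  also have "\<dots> = y * x * z" by (simp only: e mult.assoc)
  also have "\<dots> = x * z * z" by (simp only: y(1)[symmetric] e)
  also have "\<dots> = z" by (simp only: z(1,3))
  finally show ?thesis .
qed

lemma two_power_minus_one_inj:
  assumes "2 ^ m - 1 = 2 ^ n - (1::nat)"
  shows "m = n"
proof -
  have "(1::nat) \<le> 2 ^ m" "(1::nat) \<le> 2 ^ n" by simp_all
  then have "(2::nat) ^ m = 2 ^ n" using assms by linarith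
  then show ?thesis by simp
qed

text \<open>With shifted exponents, index \<open>2 ^ m - 1\<close> stands for the power
  \<open>2 ^ m\<close>, the result of \<open>m\<close> squarings.\<close>

lemma spow_two_power_square:
  "spow x (2 ^ m - 1) * spow x (2 ^ m - 1) = spow x (2 ^ Suc m - 1)"
proof -
  obtain p where p: "(2::nat) ^ m = Suc p"
    using not0_implies_Suc[of "2 ^ m"] by auto
  have "(2::nat) ^ Suc m - 1 = p + p + 1" by (simp add: p)
  then show ?thesis by (simp only: p spow_mult diff_Suc_1)
qed

lemma nonperiodic_spow:
  assumes "\<not> periodic x"
  shows "\<not> periodic (spow x k)"
proof
  assume "periodic (spow x k)"
  then have "finite (range (\<lambda>n. spow x (k * n + k + n)))" by (simp add: periodic_def spow_spow)
  moreover have "inj (\<lambda>n. spow x (k * n + k + n))"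
  proof (rule injI)
    fix m n assume "spow x (k * m + k + m) = spow x (k * n + k + n)"
    then have "k * m + k + m = k * n + k + n" using nonperiodic_inj_spow[OF assms] by (simp add: inj_eq)
    then have "Suc k * m = Suc k * n" by simp
    then show "m = n" by (simp only: mult_cancel1) simp
  qed
  ultimately show False using finite_imageD infinite_UNIV_nat by blast
qed

text \<open>Iterated squares of a nonperiodic element never repeat, and a pair of distinct periodic
  group inverses is a cycle of length two; in both cases all returns are even.\<close>

lemma square_and_inverse_separating_coloring:
  obtains c :: "'a::semigroup_mult \<Rightarrow> nat"
  where "coloring 2 c" "\<And>x. \<not> periodic x \<Longrightarrow> c (x * x) \<noteq> c x"
    "\<And>x y. periodic x \<Longrightarrow> periodic y \<Longrightarrow> group_inverse x y \<Longrightarrow> x \<noteq> y \<Longrightarrow> c x \<noteq> c y"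
proof -
  \<comment> \<open>For a periodic element without group inverse the \<open>THE\<close> term is
    unspecified; nothing is claimed about its color.\<close>
  define f :: "'a \<Rightarrow> 'a" where
    "f x = (if periodic x then (THE y. group_inverse x y) else x * x)" for x
  obtain c :: "'a \<Rightarrow> bool" where c: "\<And>x. (\<forall>m n. (f ^^ m) x = (f ^^ n) x \<longrightarrow> even (m + n)) \<Longrightarrow> c (f x) \<noteq> c x"
    using alternating_coloring[of f] by blast
  have fn: "f x = x * x" if "\<not> periodic x" for x using that by (simp add: f_def)
  have fp: "f x = y" if "periodic x" "group_inverse x y" for x y
  proof -
    have "(THE y. group_inverse x y) = y"
      using that(2) by (rule the_equality) (rule group_inverse_unique[OF _ that(2)])
    then show ?thesis using that(1) by (simp add: f_def)
  qed
  have sq: "c (x * x) \<noteq> c x" if x: "\<not> periodic x" for x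
  proof -
    have f: "(f ^^ m) x = spow x (2 ^ m - 1)" for m
    proof (induction m)
      case (Suc m)
      have "(f ^^ Suc m) x = spow x (2 ^ m - 1) * spow x (2 ^ m - 1)"
        by (simp add: Suc fn[OF nonperiodic_spow[OF x]])
      then show ?case by (simp only: spow_two_power_square)
    qed simp
    have "even (m + n)" if eq: "(f ^^ m) x = (f ^^ n) x" for m n
    proof -
      have "2 ^ m - 1 = 2 ^ n - (1::nat)"
        using eq nonperiodic_inj_spow[OF x] by (simp add: f inj_eq)
      then have "m = n" by (rule two_power_minus_one_inj)
      then show ?thesis by simp
    qed
    then have "c (f x) \<noteq> c x" by (intro c) blast
    then show ?thesis by (simp add: fn[OF x])
  qed
  have iv: "c x \<noteq> c y" if xy: "periodic x" "periodic y" "group_inverse x y" "x \<noteq> y" for x y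
  proof -
    have fx: "f x = y" using xy(1,3) by (rule fp)
    have fy: "f y = x" using xy(2) group_inverse_sym[OF xy(3)] by (rule fp)
    have "(f ^^ m) x = (if even m then x else y)" for m
      by (induction m) (auto simp: fx fy)
    then have "\<forall>m n. (f ^^ m) x = (f ^^ n) x \<longrightarrow> even (m + n)"
      using xy(4) by simp
    then have "c (f x) \<noteq> c x" by (rule c)
    then show ?thesis by (simp add: fx)
  qed
  show thesis
  proof (rule that[of "\<lambda>x. of_bool (c x)"])
    show "coloring 2 (\<lambda>x. of_bool (c x))" by (simp add: coloring_def)
  qed (use sq iv in \<open>simp_all add: of_bool_eq_iff\<close>)
qed

text \<open>The iterated squares of a nonperiodic element are distinct and change color at every
  step, so they cannot almost all have one color.\<close>

lemma almost_monochromatic_imp_periodic: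
  assumes sq: "\<And>x::'a::semigroup_mult. \<not> periodic x \<Longrightarrow> c (x * x) \<noteq> c x"
    and T: "subsemigroup T" "almost_monochromatic c T" "x \<in> T"
  shows "periodic x"
proof (rule ccontr)
  assume x: "\<not> periodic x"
  obtain i where i: "finite {x \<in> T. c x \<noteq> i}" using T(2) by (auto simp: almost_monochromatic_def)
  define s where "s m = spow x (2 ^ m - 1)" for m :: nat
  have sinj: "inj s"
  proof (rule injI)
    fix m n assume "s m = s n"
    then have "2 ^ m - 1 = 2 ^ n - (1::nat)"
      using nonperiodic_inj_spow[OF x] by (simp add: s_def inj_eq)
    then show "m = n" by (rule two_power_minus_one_inj)
  qed
  have sS: "s (Suc m) = s m * s m" for m
    unfolding s_def by (rule spow_two_power_square[symmetric])
  have "finite (s -` {x \<in> T. c x \<noteq> i})" using i sinj by (rule finite_vimageI)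
  then obtain N where N: "\<And>m. s m \<in> {x \<in> T. c x \<noteq> i} \<Longrightarrow> m < N"
    by (auto simp: finite_nat_set_iff_bounded)
  have "c (s m) = i" if "N \<le> m" for m
    using N[of m] that spow_in[OF T(1,3)] by (auto simp: s_def)
  then have "c (s (Suc N)) = c (s N)" by simp
  then show False using sq[of "s N"] nonperiodic_spow[OF x] by (simp add: sS) (simp add: s_def)
qed

text \<open>Of an element and its distinct inverse, at least one misses the dominant color, so only
  finitely many elements are not involutions. Given \<open>g\<close>, one can then choose
  \<open>x\<close> and \<open>y\<close> with \<open>x\<close>, \<open>y\<close>,
  \<open>x * y\<close> and their left multiples by \<open>g\<close> all squaring to
  \<open>e\<close>, which forces \<open>g * g = e\<close>.\<close>

lemma almost_monochromatic_group_imp_involutive: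
  fixes G :: "'a::semigroup_mult set"
  assumes G: "is_subgroup G e" "infinite G" "\<And>x. x \<in> G \<Longrightarrow> periodic x" "almost_monochromatic c G"
    and iv: "\<And>x y. periodic x \<Longrightarrow> periodic y \<Longrightarrow> group_inverse x y \<Longrightarrow> x \<noteq> y \<Longrightarrow> c x \<noteq> c y"
    and g: "g \<in> G"
  shows "g * g = e"
proof -
  note ma = mult.assoc
  have eG: "e \<in> G" and Gm: "\<And>x y. x \<in> G \<Longrightarrow> y \<in> G \<Longrightarrow> x * y \<in> G"
    and Ge: "\<And>x. x \<in> G \<Longrightarrow> e * x = x" "\<And>x. x \<in> G \<Longrightarrow> x * e = x"
    using G(1) by (auto simp: is_subgroup_def)
  have "\<forall>x\<in>G. \<exists>y. y \<in> G \<and> x * y = e \<and> y * x = e" using G(1) by (auto simp: is_subgroup_def)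
  then obtain iv where ivG: "\<And>x. x \<in> G \<Longrightarrow> iv x \<in> G"
    and iv1: "\<And>x. x \<in> G \<Longrightarrow> x * iv x = e" and iv2: "\<And>x. x \<in> G \<Longrightarrow> iv x * x = e" by metis
  have lc: "b = d" if "a \<in> G" "b \<in> G" "d \<in> G" "a * b = a * d" for a b d
    using that by (metis Ge(1) iv2 ma)
  have rc: "b = d" if "a \<in> G" "b \<in> G" "d \<in> G" "b * a = d * a" for a b d
    using that by (metis Ge(2) iv1 ma)
  obtain i where i: "finite {x \<in> G. c x \<noteq> i}" using G(4) by (auto simp: almost_monochromatic_def)
  define B where "B = {x \<in> G. c x \<noteq> i}"
  define N where "N = {x \<in> G. x * x \<noteq> e}"
  have "N \<subseteq> B \<union> iv ` B"
  proof
    fix x assume x: "x \<in> N"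
    then have xG: "x \<in> G" by (simp add: N_def)
    have "x \<noteq> iv x" using x iv1[OF xG] by (auto simp: N_def)
    moreover have "group_inverse x (iv x)"
      using xG ivG by (simp add: group_inverse_def iv1 iv2 Ge)
    ultimately have "c x \<noteq> c (iv x)" using iv G(3) xG ivG by blast
    then have "x \<in> B \<or> iv x \<in> B" using xG ivG by (auto simp: B_def)
    moreover have "iv (iv x) = x"
      using lc[of "iv x" "iv (iv x)" x] xG ivG iv1 iv2 by simp
    ultimately show "x \<in> B \<union> iv ` B" by (metis UnI1 UnI2 imageI)
  qed
  then have N: "finite N" using i finite_subset by (auto simp: B_def)
  have Nh: "finite {x \<in> G. h * x \<in> N}" if h: "h \<in> G" for h
  proof (rule finite_subset)
    show "{x \<in> G. h * x \<in> N} \<subseteq> (*) (iv h) ` N"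
    proof
      fix x assume x: "x \<in> {x \<in> G. h * x \<in> N}"
      then have "x = iv h * (h * x)" using h by (simp add: ma[symmetric] iv2 Ge)
      then show "x \<in> (*) (iv h) ` N" using x by blast
    qed
  qed (use N in simp)
  have pick: "\<exists>x\<in>G. \<forall>h\<in>S. (h * x) * (h * x) = e" if S: "finite S" "S \<subseteq> G" for S
  proof -
    have "finite (\<Union>h\<in>S. {x \<in> G. h * x \<in> N})" using S Nh by auto
    then have "\<not> G \<subseteq> (\<Union>h\<in>S. {x \<in> G. h * x \<in> N})" using G(2) finite_subset by blast
    then obtain x where x: "x \<in> G" "x \<notin> (\<Union>h\<in>S. {x \<in> G. h * x \<in> N})" by blast
    then show ?thesis using S Gm by (intro bexI[of _ x]) (auto simp: N_def)
  qed
  \<comment> \<open>Obtained by cancelling \<open>u\<close> on the right in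
    \<open>g * u * g * u = u * u\<close>.\<close>
  have flip: "g * u * g = u" if "u \<in> G" "u * u = e" "(g * u) * (g * u) = e" for u
    using rc[of u "g * u * g" u] that g Gm by (simp add: ma)
  obtain x where x: "x \<in> G" "x * x = e" "(g * x) * (g * x) = e"
    using pick[of "{e, g}"] eG g Ge by auto
  obtain y where y: "y \<in> G" "y * y = e" "(g * y) * (g * y) = e"
    "(x * y) * (x * y) = e" "(g * (x * y)) * (g * (x * y)) = e"
    using pick[of "{e, g, x, g * x}"] eG g x(1) Gm Ge by (auto simp: ma)
  \<comment> \<open>Both sides equal \<open>x * y\<close> by \<open>flip\<close>. Comparing them
    exposes the factor \<open>g * g\<close> between \<open>x\<close> and \<open>y\<close>.\<close>
  have "g * (x * y) * g = (g * x * g) * (g * y * g)"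
    using flip[of x] flip[of y] flip[of "x * y"] x y Gm by simp
  then have "(g * x) * y = (g * x) * ((g * g) * y)"
    using rc[of g "(g * x) * y" "(g * x) * ((g * g) * y)"] g x y Gm by (simp add: ma)
  then have "e * y = (g * g) * y"
    using lc[of "g * x" y "(g * g) * y"] g x y Gm Ge by simp
  then show ?thesis using rc[of y e "g * g"] g y eG Gm by simp
qed

section \<open>Involutive groups\<close>

text \<open>An elementary abelian 2-group, that is, a vector space over the two-element field, on a
  carrier set; every element is its own inverse.\<close>

locale involutive_group =
  fixes G :: "'a::semigroup_mult set" and e :: 'a
  assumes one_closed: "e \<in> G"
    and mult_closed: "x \<in> G \<Longrightarrow> y \<in> G \<Longrightarrow> x * y \<in> G"
    and one_mult: "x \<in> G \<Longrightarrow> e * x = x"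
    and mult_one: "x \<in> G \<Longrightarrow> x * e = x"
    and involutive: "x \<in> G \<Longrightarrow> x * x = e"
begin

lemma commute:
  assumes "x \<in> G" "y \<in> G"
  shows "x * y = y * x"
proof -
  have "y * x = x * ((x * y) * (x * y)) * y"
    using assms by (simp add: mult.assoc involutive mult_one mult_closed)
      (simp add: mult.assoc[symmetric] involutive one_mult mult_closed)
  also have "\<dots> = x * y" using assms by (simp add: involutive mult_one mult_closed)
  finally show ?thesis by simp
qed

lemma left_cancel:
  assumes "x \<in> G" "y \<in> G"
  shows "x * (x * y) = y"
  using assms by (simp add: mult.assoc[symmetric] involutive one_mult)

definition finite_subspace :: "'a set \<Rightarrow> bool" where
  "finite_subspace H \<longleftrightarrow> finite H \<and> H \<subseteq> G \<and> e \<in> H \<and> (\<forall>x\<in>H. \<forall>y\<in>H. x * y \<in> H)"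

lemma finite_subspace_one: "finite_subspace {e}"
  by (simp add: finite_subspace_def one_closed involutive)

lemma finite_subspace_adjoin:
  assumes H: "finite_subspace H" and g: "g \<in> G"
  shows "finite_subspace (H \<union> (\<lambda>h. h * g) ` H)"
proof -
  have HG: "h \<in> G" if "h \<in> H" for h using H that by (auto simp: finite_subspace_def)
  have HH: "h * k \<in> H" if "h \<in> H" "k \<in> H" for h k using H that by (auto simp: finite_subspace_def)
  have 1: "(h * g) * k = (h * k) * g" if "h \<in> H" "k \<in> H" for h k
    using commute[OF g HG[OF that(2)]] by (simp add: mult.assoc)
  have 2: "(h * g) * (k * g) = h * k" if "h \<in> H" "k \<in> H" for h k
  proof -
    have "(h * g) * (k * g) = ((h * g) * k) * g" by (simp only: mult.assoc)
    also have "\<dots> = ((h * k) * g) * g" by (simp only: 1[OF that])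
    also have "\<dots> = (h * k) * (g * g)" by (simp only: mult.assoc)
    also have "\<dots> = h * k" using HG[OF HH[OF that]] g by (simp add: involutive mult_one)
    finally show ?thesis .
  qed
  have "x * y \<in> H \<union> (\<lambda>h. h * g) ` H"
    if xy: "x \<in> H \<union> (\<lambda>h. h * g) ` H" "y \<in> H \<union> (\<lambda>h. h * g) ` H" for x y
    using xy HH by (auto simp: 1 2) (auto simp: mult.assoc[symmetric])
  then show ?thesis using H g mult_closed by (auto simp: finite_subspace_def)
qed

end

text \<open>A linear combination over the two-element field, written multiplicatively: the first
  \<open>n\<close> members of \<open>g\<close> with coefficients \<open>v\<close>. The recursion
  fixes an order of the factors, since they commute only inside the carrier.\<close>

primrec bit_prod :: "'a::semigroup_mult \<Rightarrow> (nat \<Rightarrow> 'a) \<Rightarrow> (nat \<Rightarrow> bit) \<Rightarrow> nat \<Rightarrow> 'a" where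
  "bit_prod e g v 0 = e"
| "bit_prod e g v (Suc n) = (if v n = 1 then bit_prod e g v n * g n else bit_prod e g v n)"

lemma bit_prod_stable:
  assumes "\<forall>k\<ge>m. v k = 0" "m \<le> n"
  shows "bit_prod e g v n = bit_prod e g v m"
  using assms(2) by (induction rule: dec_induct) (auto simp: assms(1))

lemma (in involutive_group) bit_prod_closed:
  assumes "\<And>n. g n \<in> G"
  shows "bit_prod e g v n \<in> G"
  by (induction n) (auto simp: one_closed mult_closed assms)

lemma (in involutive_group) bit_prod_add:
  assumes g: "\<And>n. g n \<in> G"
  shows "bit_prod e g (\<lambda>k. v k + w k) n = bit_prod e g v n * bit_prod e g w n"
proof -
  define u where "u = (\<lambda>k. v k + w k)"
  have "bit_prod e g u n = bit_prod e g v n * bit_prod e g w n"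
  proof (induction n)
    case 0
    show ?case by (simp add: involutive one_closed)
  next
    case (Suc n)
    define a where "a = bit_prod e g v n"
    define b where "b = bit_prod e g w n"
    have IH: "bit_prod e g u n = a * b" using Suc by (simp add: a_def b_def)
    have G: "a \<in> G" "b \<in> G" "g n \<in> G" by (simp_all add: a_def b_def bit_prod_closed g)
    have 1: "(a * g n) * b = (a * b) * g n" using commute[OF G(3,2)] by (simp add: mult.assoc)
    have "(a * g n) * (b * g n) = ((a * g n) * b) * g n" by (simp only: mult.assoc)
    also have "\<dots> = ((a * b) * g n) * g n" by (simp only: 1)
    also have "\<dots> = (a * b) * (g n * g n)" by (simp only: mult.assoc)
    also have "\<dots> = a * b" using G by (simp add: involutive mult_one mult_closed)
    finally have 2: "(a * g n) * (b * g n) = a * b" .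
    have 3: "a * (b * g n) = (a * b) * g n" by (simp only: mult.assoc)
    have u: "u n = v n + w n" by (simp add: u_def)
    show ?case
      unfolding bit_prod.simps a_def[symmetric] b_def[symmetric] IH
      by (cases "v n"; cases "w n") (simp_all add: u 1 2 3)
  qed
  then show ?thesis by (simp only: u_def)
qed

text \<open>The group may be uncountable, so only the span of an independent sequence is used: each
  \<open>g n\<close> is chosen outside a finite subspace that contains all products of earlier
  members.\<close>

lemma (in involutive_group) embeds_direct_sum_Z2:
  assumes inf: "infinite G"
  shows "\<exists>T\<subseteq>G. subsemigroup T \<and> isomorphic_to_direct_sum_Z2 T"
proof -
  define P where "P = (\<lambda>(n::nat) (p :: 'a set \<times> 'a). finite_subspace (fst p) \<and> snd p \<in> G - fst p)"
  define Q where "Q = (\<lambda>(n::nat) (p :: 'a set \<times> 'a) (q :: 'a set \<times> 'a). fst q = fst p \<union> (\<lambda>h. h * snd p) ` fst p)"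
  have ex: "\<exists>g. g \<in> G - H" if "finite_subspace H" for H
  proof -
    have "infinite (G - H)" using that inf by (simp add: finite_subspace_def Diff_infinite_finite)
    then show ?thesis using infinite_imp_nonempty by blast
  qed
  have "\<exists>f. \<forall>n. P n (f n) \<and> Q n (f n) (f (Suc n))"
  proof (rule dependent_nat_choice)
    obtain g where "g \<in> G - {e}" using ex[OF finite_subspace_one] by blast
    then show "\<exists>p. P 0 p" using finite_subspace_one by (intro exI[of _ "({e}, g)"]) (simp add: P_def)
    show "\<exists>q. P (Suc n) q \<and> Q n p q" if p: "P n p" for p n
    proof -
      define H where "H = fst p \<union> (\<lambda>h. h * snd p) ` fst p"
      have H: "finite_subspace H" using p finite_subspace_adjoin by (simp add: P_def H_def)
      obtain g where "g \<in> G - H" using ex[OF H] by blast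
      then show ?thesis using H by (intro exI[of _ "(H, g)"]) (simp add: P_def Q_def H_def)
    qed
  qed
  then obtain f where f: "\<And>n. P n (f n)" "\<And>n. Q n (f n) (f (Suc n))" by blast
  define H where "H n = fst (f n)" for n
  define g where "g n = snd (f n)" for n
  have H: "finite_subspace (H n)" and g: "g n \<in> G" "g n \<notin> H n" for n
    using f(1)[of n] by (auto simp: P_def H_def g_def)
  have HS: "H (Suc n) = H n \<union> (\<lambda>h. h * g n) ` H n" for n
    using f(2)[of n] by (simp add: Q_def H_def g_def)
  have bH: "bit_prod e g v n \<in> H n" for v n
  proof (induction n)
    case 0
    then show ?case using H[of 0] by (simp add: finite_subspace_def)
  qed (simp add: HS)
  \<comment> \<open>One above the highest index in the support, and 0 for the zero vector.\<close>
  define deg where "deg v = (LEAST n. \<forall>k\<ge>n. Poly_Mapping.lookup v k = 0)" for v :: "nat \<Rightarrow>\<^sub>0 bit"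
  have deg: "\<forall>k\<ge>deg v. Poly_Mapping.lookup v k = 0" for v
  proof -
    obtain n where "\<forall>k\<in>Poly_Mapping.keys v. k < n" using finite_keys[of v] by (auto simp: finite_nat_set_iff_bounded)
    then have "\<forall>k\<ge>n. Poly_Mapping.lookup v k = 0" by (metis in_keys_iff leD)
    then show ?thesis unfolding deg_def by (rule LeastI)
  qed
  define \<phi> where "\<phi> v = bit_prod e g (Poly_Mapping.lookup v) (deg v)" for v
  have \<phi>: "\<phi> v = bit_prod e g (Poly_Mapping.lookup v) n" if "deg v \<le> n" for v n
    unfolding \<phi>_def by (rule bit_prod_stable[symmetric]) (use deg that in auto)
  have \<phi>G: "\<phi> v \<in> G" for v by (simp add: \<phi>_def bit_prod_closed g)
  have hom: "\<phi> (v + w) = \<phi> v * \<phi> w" for v w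
  proof -
    define n where "n = deg v + deg w + deg (v + w)"
    have "\<phi> (v + w) = bit_prod e g (Poly_Mapping.lookup (v + w)) n" by (rule \<phi>) (simp add: n_def)
    also have "Poly_Mapping.lookup (v + w) = (\<lambda>k. Poly_Mapping.lookup v k + Poly_Mapping.lookup w k)" by (simp add: fun_eq_iff lookup_add)
    also have "bit_prod e g (\<lambda>k. Poly_Mapping.lookup v k + Poly_Mapping.lookup w k) n = bit_prod e g (Poly_Mapping.lookup v) n * bit_prod e g (Poly_Mapping.lookup w) n"
      by (rule bit_prod_add) (rule g)
    also have "\<dots> = \<phi> v * \<phi> w" using \<phi>[of v n] \<phi>[of w n] by (simp add: n_def)
    finally show ?thesis .
  qed
  \<comment> \<open>If a nonzero vector had trivial image, its highest generator \<open>g m\<close>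
    would equal a product of lower ones and so lie in \<open>H m\<close>.\<close>
  have ker: "v = 0" if v: "\<phi> v = e" for v
  proof (cases "deg v")
    case 0
    then show ?thesis using deg[of v] by (intro poly_mapping_eqI) simp
  next
    case (Suc m)
    have "\<not> (\<forall>k\<ge>m. Poly_Mapping.lookup v k = 0)"
      using not_less_Least[of m "\<lambda>n. \<forall>k\<ge>n. Poly_Mapping.lookup v k = 0"] Suc by (simp add: deg_def)
    then have "Poly_Mapping.lookup v m \<noteq> 0" using deg[of v] by (metis Suc le_antisym not_less_eq_eq)
    then have "Poly_Mapping.lookup v m = 1" by (cases "Poly_Mapping.lookup v m") auto
    then have eq: "bit_prod e g (Poly_Mapping.lookup v) m * g m = e" using v by (simp add: \<phi>_def Suc)
    have "g m = bit_prod e g (Poly_Mapping.lookup v) m * (bit_prod e g (Poly_Mapping.lookup v) m * g m)"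
      by (simp add: left_cancel bit_prod_closed g)
    also have "\<dots> = bit_prod e g (Poly_Mapping.lookup v) m" by (simp add: eq mult_one bit_prod_closed g)
    finally show ?thesis using g(2)[of m] bH[of "Poly_Mapping.lookup v" m] by simp
  qed
  have "inj \<phi>"
  proof (rule injI)
    fix v w assume "\<phi> v = \<phi> w"
    then have "v + w = 0" using ker hom \<phi>G involutive by simp
    then have *: "Poly_Mapping.lookup v k + Poly_Mapping.lookup w k = 0" for k by (metis lookup_add lookup_zero)
    show "v = w"
    proof (rule poly_mapping_eqI)
      show "Poly_Mapping.lookup v k = Poly_Mapping.lookup w k" for k
        using *[of k] by (cases "Poly_Mapping.lookup v k"; cases "Poly_Mapping.lookup w k") auto
    qed
  qed
  then have "isomorphic_to_direct_sum_Z2 (range \<phi>)"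
    unfolding isomorphic_to_direct_sum_Z2_def using hom by (intro exI[of _ \<phi>]) (simp add: bij_betw_def)
  moreover have "subsemigroup (range \<phi>)"
    unfolding subsemigroup_def by (auto simp: hom[symmetric])
  ultimately show ?thesis using \<phi>G by blast
qed

lemma isomorphic_to_direct_sum_Z2_imp_involutive_group:
  fixes T :: "'a::semigroup_mult set"
  assumes "isomorphic_to_direct_sum_Z2 T"
  shows "infinite T" "\<exists>e. involutive_group T e"
proof -
  obtain \<phi> :: "(nat \<Rightarrow>\<^sub>0 bit) \<Rightarrow> 'a" where \<phi>: "bij_betw \<phi> UNIV T" "\<And>x y. \<phi> (x + y) = \<phi> x * \<phi> y"
    using assms by (auto simp: isomorphic_to_direct_sum_Z2_def)
  have T: "T = range \<phi>" using \<phi>(1) by (simp add: bij_betw_def)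
  have "inj (\<lambda>n. Poly_Mapping.single n (1::bit))"
    by (rule injI) (metis lookup_single_eq lookup_single_not_eq zero_neq_one)
  then have "infinite (UNIV :: (nat \<Rightarrow>\<^sub>0 bit) set)"
    using infinite_UNIV_nat finite_subset[OF subset_UNIV] finite_imageD by blast
  then show "infinite T" using \<phi>(1) bij_betw_finite by blast
  have add_self: "v + v = 0" for v :: "nat \<Rightarrow>\<^sub>0 bit"
  proof (rule poly_mapping_eqI)
    show "Poly_Mapping.lookup (v + v) k = Poly_Mapping.lookup 0 k" for k
      unfolding lookup_add lookup_zero by (cases "Poly_Mapping.lookup v k") simp_all
  qed
  show "\<exists>e. involutive_group T e"
    by (rule exI[of _ "\<phi> 0"], unfold_locales) (auto simp: T \<phi>(2)[symmetric] add_self)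
qed

section \<open>Idempotent ultrafilters\<close>

text \<open>On ultrafilters this is the product of the Stone-Cech compactification. For filters,
  \<open>conv F F \<le> F\<close> makes the ultrafilters below \<open>F\<close> a closed
  subsemigroup.\<close>

definition conv :: "'a::semigroup_mult filter \<Rightarrow> 'a filter \<Rightarrow> 'a filter" where
  "conv F G = Abs_filter (\<lambda>P. eventually (\<lambda>x. eventually (\<lambda>y. P (x * y)) G) F)"

lemma eventually_conv:
  "eventually P (conv F G) \<longleftrightarrow> eventually (\<lambda>x. eventually (\<lambda>y. P (x * y)) G) F"
  unfolding conv_def
proof (rule eventually_Abs_filter, rule is_filter.intro)
  fix P Q
  show "eventually (\<lambda>x. eventually (\<lambda>y. True) G) F" by simp
  show "eventually (\<lambda>x. eventually (\<lambda>y. P (x * y) \<and> Q (x * y)) G) F"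
    if "eventually (\<lambda>x. eventually (\<lambda>y. P (x * y)) G) F" "eventually (\<lambda>x. eventually (\<lambda>y. Q (x * y)) G) F"
    using that by (simp add: eventually_conj_iff)
  show "eventually (\<lambda>x. eventually (\<lambda>y. Q (x * y)) G) F"
    if "\<forall>x. P x \<longrightarrow> Q x" "eventually (\<lambda>x. eventually (\<lambda>y. P (x * y)) G) F"
    using that(2) by (rule eventually_mono) (use that(1) in \<open>auto elim: eventually_mono\<close>)
qed

lemma conv_mono: "F \<le> F' \<Longrightarrow> G \<le> G' \<Longrightarrow> conv F G \<le> conv F' G'"
  unfolding le_filter_def eventually_conv by (metis (mono_tags, lifting) eventually_mono)

lemma conv_assoc: "conv (conv F G) H = conv F (conv G H)"
  by (simp add: filter_eq_iff eventually_conv mult.assoc)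

lemma conv_bot_iff: "conv F G = bot \<longleftrightarrow> F = bot \<or> G = bot"
  by (cases "G = bot") (auto simp: eventually_conv trivial_limit_def)

text \<open>Compactness in filter form: an event that holds eventually in the infimum of a chain
  already holds eventually in one of its members.\<close>

lemma Inf_chain_filter_neq_bot:
  assumes "C \<noteq> {}" "\<And>F. F \<in> C \<Longrightarrow> F \<noteq> bot" "\<And>F G. F \<in> C \<Longrightarrow> G \<in> C \<Longrightarrow> F \<le> G \<or> G \<le> F"
  shows "Inf C \<noteq> (bot :: 'a filter)"
proof
  assume "Inf C = bot"
  then have "eventually (\<lambda>_. False) (Inf C)" by simp
  moreover have "\<exists>x\<in>C. x \<le> inf F G" if "F \<in> C" "G \<in> C" for F G
    using assms(3)[OF that] that by (metis inf.absorb1 inf.absorb2 order_refl)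
  ultimately obtain F where "F \<in> C" "eventually (\<lambda>_. False) F"
    using eventually_Inf_base[OF assms(1)] by metis
  then show False using assms(2) by (auto simp: trivial_limit_def)
qed

lemma minimal_filter_exists:
  fixes A :: "'a filter set"
  assumes "A \<noteq> {}" and Inf: "\<And>C. C \<noteq> {} \<Longrightarrow> C \<subseteq> A \<Longrightarrow> (\<And>F G. F \<in> C \<Longrightarrow> G \<in> C \<Longrightarrow> F \<le> G \<or> G \<le> F) \<Longrightarrow> Inf C \<in> A"
  shows "\<exists>M\<in>A. \<forall>F\<in>A. F \<le> M \<longrightarrow> F = M"
proof -
  have "\<exists>M\<in>A. \<forall>F\<in>A. M \<ge> F \<longrightarrow> F = M"
  proof (rule predicate_Zorn)
    show "partial_order_on A (relation_of (\<lambda>F G. F \<ge> G) A)"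
      by (rule partial_order_on_relation_ofI) auto
    show "\<exists>u\<in>A. \<forall>a\<in>C. a \<ge> u" if C: "C \<in> Chains (relation_of (\<lambda>F G. F \<ge> G) A)" for C
    proof (cases "C = {}")
      case False
      have "C \<subseteq> A" "\<And>F G. F \<in> C \<Longrightarrow> G \<in> C \<Longrightarrow> F \<le> G \<or> G \<le> F"
        using C by (auto simp: Chains_def relation_of_def)
      then have "Inf C \<in> A" using Inf False by blast
      then show ?thesis by (meson Inf_lower)
    qed (use assms(1) in auto)
  qed
  then show ?thesis .
qed

text \<open>The Ellis-Numakura argument. A minimal \<open>F\<close> with
  \<open>conv F F \<le> F\<close> plays the minimal closed subsemigroup, and \<open>U\<close> is an
  ultrafilter below it. Minimality is used twice, first for \<open>F * U\<close> and then for the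
  stabilizer of \<open>U\<close> in \<open>F\<close>, and shows \<open>F = U\<close>.\<close>

lemma idempotent_ultrafilter_exists:
  fixes F0 :: "'a::semigroup_mult filter"
  assumes F0: "F0 \<noteq> bot" "conv F0 F0 \<le> F0"
  obtains U where "U \<le> F0" "U \<noteq> bot" "conv U U = U"
    "\<And>P. eventually P U \<or> eventually (\<lambda>x. \<not> P x) U"
proof -
  define A where "A = {F. F \<noteq> bot \<and> F \<le> F0 \<and> conv F F \<le> F}"
  have "\<exists>M\<in>A. \<forall>F\<in>A. F \<le> M \<longrightarrow> F = M"
  proof (rule minimal_filter_exists)
    show "A \<noteq> {}" using F0 by (auto simp: A_def)
    fix C assume C: "C \<noteq> {}" "C \<subseteq> A" "\<And>F G. F \<in> C \<Longrightarrow> G \<in> C \<Longrightarrow> F \<le> G \<or> G \<le> F"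
    have "Inf C \<noteq> bot" using C by (intro Inf_chain_filter_neq_bot) (auto simp: A_def)
    moreover have "Inf C \<le> F0" using C(1,2) by (auto simp: A_def intro: Inf_lower2)
    moreover have "conv (Inf C) (Inf C) \<le> Inf C"
    proof (rule Inf_greatest)
      fix F assume "F \<in> C"
      then have "conv (Inf C) (Inf C) \<le> conv F F" by (intro conv_mono Inf_lower)
      also have "\<dots> \<le> F" using \<open>F \<in> C\<close> C(2) by (auto simp: A_def)
      finally show "conv (Inf C) (Inf C) \<le> F" .
    qed
    ultimately show "Inf C \<in> A" by (simp add: A_def)
  qed
  then obtain F where F: "F \<noteq> bot" "F \<le> F0" "conv F F \<le> F"
    and Fmin: "\<And>G. G \<noteq> bot \<Longrightarrow> conv G G \<le> G \<Longrightarrow> G \<le> F \<Longrightarrow> G = F"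
    by (auto simp: A_def)
  have "\<exists>M\<in>{U. U \<noteq> bot \<and> U \<le> F}. \<forall>U\<in>{U. U \<noteq> bot \<and> U \<le> F}. U \<le> M \<longrightarrow> U = M"
  proof (rule minimal_filter_exists)
    show "{U. U \<noteq> bot \<and> U \<le> F} \<noteq> {}" using F by auto
    show "Inf C \<in> {U. U \<noteq> bot \<and> U \<le> F}"
      if C: "C \<noteq> {}" "C \<subseteq> {U. U \<noteq> bot \<and> U \<le> F}" "\<And>F G. F \<in> C \<Longrightarrow> G \<in> C \<Longrightarrow> F \<le> G \<or> G \<le> F" for C
    proof -
      have "Inf C \<noteq> bot" using C by (intro Inf_chain_filter_neq_bot) auto
      moreover have "Inf C \<le> F" using C(1,2) by (auto intro: Inf_lower2)
      ultimately show ?thesis by simp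
    qed
  qed
  then obtain U where U: "U \<noteq> bot" "U \<le> F"
    and Umin: "\<And>V. V \<noteq> bot \<Longrightarrow> V \<le> U \<Longrightarrow> V = U"
    by auto
  have ultra: "eventually P U \<or> eventually (\<lambda>x. \<not> P x) U" for P
  proof (cases "inf U (principal {x. P x}) = bot")
    case True
    then have "eventually (\<lambda>x. \<not> P x) U" by (simp add: trivial_limit_def eventually_inf_principal)
    then show ?thesis by blast
  next
    case False
    then have "inf U (principal {x. P x}) = U" by (intro Umin) simp_all
    moreover have "eventually P (inf U (principal {x. P x}))" by (simp add: eventually_inf_principal)
    ultimately show ?thesis by simp
  qed
  have FU: "conv F U = F"
  proof (rule Fmin)
    show "conv F U \<noteq> bot" using F U by (simp add: conv_bot_iff)
    show le: "conv F U \<le> F" using conv_mono[OF order_refl U(2)] F(3) by (meson order_trans)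
    have "conv (conv F U) (conv F U) \<le> conv F (conv F U)" by (rule conv_mono[OF le order_refl])
    also have "\<dots> = conv (conv F F) U" by (simp add: conv_assoc)
    also have "\<dots> \<le> conv F U" by (rule conv_mono[OF F(3) order_refl])
    finally show "conv (conv F U) (conv F U) \<le> conv F U" .
  qed
  \<comment> \<open>In terms of ultrafilters, \<open>K\<close> is the closed set of all \<open>q\<close> with \<open>q * U = U\<close>.\<close>
  define K where "K = Abs_filter (\<lambda>Q. \<exists>P. eventually P U \<and> (\<forall>x. eventually (\<lambda>y. P (x * y)) U \<longrightarrow> Q x))"
  have K: "eventually Q K \<longleftrightarrow> (\<exists>P. eventually P U \<and> (\<forall>x. eventually (\<lambda>y. P (x * y)) U \<longrightarrow> Q x))" for Q
    unfolding K_def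
  proof (rule eventually_Abs_filter, rule is_filter.intro)
    show "\<exists>P. eventually P U \<and> (\<forall>x. eventually (\<lambda>y. P (x * y)) U \<longrightarrow> True)"
      by (auto intro: exI[of _ "\<lambda>_. True"])
    fix Q R :: "'a \<Rightarrow> bool"
    show "\<exists>P. eventually P U \<and> (\<forall>x. eventually (\<lambda>y. P (x * y)) U \<longrightarrow> Q x \<and> R x)"
      if "\<exists>P. eventually P U \<and> (\<forall>x. eventually (\<lambda>y. P (x * y)) U \<longrightarrow> Q x)"
        "\<exists>P. eventually P U \<and> (\<forall>x. eventually (\<lambda>y. P (x * y)) U \<longrightarrow> R x)"
    proof -
      obtain P P' where "eventually P U" "\<forall>x. eventually (\<lambda>y. P (x * y)) U \<longrightarrow> Q x"
        "eventually P' U" "\<forall>x. eventually (\<lambda>y. P' (x * y)) U \<longrightarrow> R x"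
        using \<open>\<exists>P. _ P \<and> (\<forall>x. _ P x \<longrightarrow> Q x)\<close> \<open>\<exists>P. _ P \<and> (\<forall>x. _ P x \<longrightarrow> R x)\<close> by blast
      then show ?thesis
        by (intro exI[of _ "\<lambda>x. P x \<and> P' x"]) (auto simp: eventually_conj_iff)
    qed
    show "\<exists>P. eventually P U \<and> (\<forall>x. eventually (\<lambda>y. P (x * y)) U \<longrightarrow> R x)"
      if "\<forall>x. Q x \<longrightarrow> R x" "\<exists>P. eventually P U \<and> (\<forall>x. eventually (\<lambda>y. P (x * y)) U \<longrightarrow> Q x)"
      using that by blast
  qed
  have KU: "eventually (\<lambda>x. eventually (\<lambda>y. P (x * y)) U) K" if "eventually P U" for P
    using that by (auto simp: K)
  define G where "G = inf F K"
  have GF: "G \<le> F" and GK: "G \<le> K" by (simp_all add: G_def)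
  have "G = F"
  proof (rule Fmin)
    \<comment> \<open>If \<open>F\<close> and \<open>K\<close> were incompatible, some
      \<open>P\<close> in \<open>U\<close> would fail eventually along \<open>conv F U = F\<close>,
      hence along the finer filter \<open>U\<close>.\<close>
    show "G \<noteq> bot"
    proof
      assume "G = bot"
      then have "eventually (\<lambda>_. False) (inf F K)" by (simp add: G_def)
      then obtain B C where B: "eventually B F" and C: "eventually C K" and BC: "\<And>x. B x \<Longrightarrow> C x \<Longrightarrow> False"
        unfolding eventually_inf by blast
      obtain P where P: "eventually P U" "\<And>x. eventually (\<lambda>y. P (x * y)) U \<Longrightarrow> C x"
        using C by (auto simp: K)
      have "eventually (\<lambda>x. eventually (\<lambda>y. \<not> P (x * y)) U) F"
        using B by (rule eventually_mono) (use BC P(2) ultra in blast)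
      then have "eventually (\<lambda>x. \<not> P x) (conv F U)" by (simp add: eventually_conv)
      then have "eventually (\<lambda>x. \<not> P x) U" using FU U(2) by (simp add: le_filter_def)
      with P(1) have "eventually (\<lambda>_. False) U" by eventually_elim simp
      with U(1) show False by (simp add: trivial_limit_def)
    qed
    show "G \<le> F" by (rule GF)
    show "conv G G \<le> G"
    proof (rule filter_leI)
      fix Q assume "eventually Q G"
      then obtain B C where B: "eventually B F" and C: "eventually C K" and BC: "\<And>x. B x \<Longrightarrow> C x \<Longrightarrow> Q x"
        unfolding G_def eventually_inf by blast
      obtain P where P: "eventually P U" "\<And>x. eventually (\<lambda>y. P (x * y)) U \<Longrightarrow> C x"
        using C by (auto simp: K)
      have "eventually B (conv G G)"
        using B filter_leD[OF order_trans[OF conv_mono[OF GF GF] F(3)]] by blast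
      moreover have "eventually C (conv G G)"
        unfolding eventually_conv
      proof -
        have "eventually (\<lambda>x. eventually (\<lambda>y. P (x * y)) U) G"
          using KU[OF P(1)] by (rule filter_leD[OF GK])
        then show "eventually (\<lambda>x. eventually (\<lambda>y. C (x * y)) G) G"
        proof (rule eventually_mono)
          fix x assume "eventually (\<lambda>y. P (x * y)) U"
          from KU[OF this] have "eventually (\<lambda>y. eventually (\<lambda>z. P (x * (y * z))) U) G"
            by (rule filter_leD[OF GK])
          then show "eventually (\<lambda>y. C (x * y)) G"
            by (rule eventually_mono) (rule P(2), simp add: mult.assoc)
        qed
      qed
      ultimately show "eventually Q (conv G G)" by eventually_elim (rule BC)
    qed
  qed
  \<comment> \<open>All of \<open>F\<close> now stabilizes \<open>U\<close>, so every event of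
    \<open>U\<close> is one of \<open>conv F U\<close>, which is \<open>F\<close>.\<close>
  have "F \<le> U"
  proof (rule filter_leI)
    fix P assume "eventually P U"
    then have "eventually (\<lambda>x. eventually (\<lambda>y. P (x * y)) U) G"
      by (intro filter_leD[OF GK] KU)
    then show "eventually P F" using \<open>G = F\<close> FU by (metis eventually_conv)
  qed
  with U(2) have "F = U" by simp
  show thesis by (rule that[of U]) (use U F FU \<open>F = U\<close> ultra in auto)
qed

lemma ultrafilter_picks_color:
  assumes ultra: "\<And>P. eventually P U \<or> eventually (\<lambda>x. \<not> P x) U" and "U \<noteq> bot"
    and c: "coloring k c"
  shows "\<exists>i. eventually (\<lambda>x. c x = i) U"
proof -
  have "\<exists>i. eventually (\<lambda>x. c x = i) U" if "eventually (\<lambda>x. c x < n) U" for n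
    using that
  proof (induction n)
    case 0
    then show ?case using \<open>U \<noteq> bot\<close> by (simp add: trivial_limit_def)
  next
    case (Suc n)
    show ?case
    proof (cases "eventually (\<lambda>x. c x = n) U")
      case False
      then have "eventually (\<lambda>x. c x \<noteq> n) U" using ultra by blast
      with Suc.prems have "eventually (\<lambda>x. c x < n) U" by eventually_elim simp
      then show ?thesis by (rule Suc.IH)
    qed blast
  qed
  moreover have "eventually (\<lambda>x. c x < k) U" using c by (simp add: coloring_def)
  ultimately show ?thesis .
qed

text \<open>Starting from the cofinite filter on \<open>G\<close> makes the idempotent ultrafilter
  avoid finite sets, so each step finds a new element. The color of \<open>e\<close> is never
  controlled, so the result is only almost monochromatic.\<close>

lemma (in involutive_group) almost_monochromatic_subgroup_exists:
  assumes inf: "infinite G" and c: "finite_coloring c"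
  shows "\<exists>T\<subseteq>G. subsemigroup T \<and> infinite T \<and> almost_monochromatic c T"
proof -
  obtain k where k: "coloring k c" using c by (auto simp: finite_coloring_def)
  define F0 where "F0 = inf cofinite (principal G)"
  have F0: "eventually P F0 \<longleftrightarrow> finite {x \<in> G. \<not> P x}" for P
    by (simp add: F0_def eventually_inf_principal eventually_cofinite)
  have F0bot: "F0 \<noteq> bot" using inf by (simp add: trivial_limit_def F0)
  have F0conv: "conv F0 F0 \<le> F0"
  proof (rule filter_leI)
    fix P assume P: "eventually P F0"
    have "finite {y \<in> G. \<not> P (x * y)}" if x: "x \<in> G" for x
    proof (rule finite_subset)
      show "{y \<in> G. \<not> P (x * y)} \<subseteq> (*) x ` {z \<in> G. \<not> P z}"
      proof
        fix y assume "y \<in> {y \<in> G. \<not> P (x * y)}"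
        then show "y \<in> (*) x ` {z \<in> G. \<not> P z}"
          using x mult_closed left_cancel[OF x, of y] by (intro image_eqI[of _ _ "x * y"]) auto
      qed
      show "finite ((*) x ` {z \<in> G. \<not> P z})" using P by (simp add: F0)
    qed
    \<comment> \<open>Left translations are injective, so they preserve cofinite sets.\<close>
    then have "{x \<in> G. \<not> finite {y \<in> G. \<not> P (x * y)}} = {}" by blast
    then show "eventually P (conv F0 F0)" unfolding eventually_conv F0 by (simp only: finite.emptyI)
  qed
  obtain U where U: "U \<le> F0" "U \<noteq> bot" "conv U U = U"
    "\<And>P. eventually P U \<or> eventually (\<lambda>x. \<not> P x) U"
    by (rule idempotent_ultrafilter_exists[OF F0bot F0conv]) (rule that)
  obtain i where i: "eventually (\<lambda>x. c x = i) U"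
    using ultrafilter_picks_color[OF U(4,2) k] by blast
  have UG: "eventually (\<lambda>x. x \<in> G) U" using U(1) by (auto simp: le_filter_def F0)
  have UH: "eventually (\<lambda>x. x \<notin> H) U" if "finite H" for H
    using U(1) that by (auto simp: le_filter_def F0)
  \<comment> \<open>The last clause is the induction reserve: for each \<open>h\<close> already
    present, most \<open>x\<close> give the coset element \<open>h * x\<close> the right
    color.\<close>
  define P where "P = (\<lambda>(n::nat) H. finite_subspace H \<and> (\<forall>h\<in>H. h \<noteq> e \<longrightarrow> c h = i) \<and>
    (\<forall>h\<in>H. eventually (\<lambda>x. c (h * x) = i) U))"
  have "\<exists>f. \<forall>n. P n (f n) \<and> f n \<subset> f (Suc n)"
  proof (rule dependent_nat_choice)
    have "eventually (\<lambda>x. c (e * x) = i) U" using i UG by eventually_elim (simp add: one_mult)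
    then show "\<exists>H. P 0 H" using finite_subspace_one by (intro exI[of _ "{e}"]) (simp add: P_def)
    fix H n assume H: "P n H"
    have Hfin: "finite H" "H \<subseteq> G" using H by (auto simp: P_def finite_subspace_def)
    \<comment> \<open>Idempotency of \<open>U\<close> turns the reserve for \<open>h\<close> into
      the reserve for \<open>h * x\<close>, for most \<open>x\<close>.\<close>
    have "eventually (\<lambda>x. c (h * x) = i \<and> eventually (\<lambda>y. c (h * x * y) = i) U) U" if "h \<in> H" for h
    proof -
      have *: "eventually (\<lambda>x. c (h * x) = i) U" using H that by (simp add: P_def)
      then have "eventually (\<lambda>x. c (h * x) = i) (conv U U)" by (simp add: U(3))
      then have "eventually (\<lambda>x. eventually (\<lambda>y. c (h * x * y) = i) U) U"
        by (simp add: eventually_conv mult.assoc)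
      with * show ?thesis by eventually_elim simp
    qed
    then have "eventually (\<lambda>x. \<forall>h\<in>H. c (h * x) = i \<and> eventually (\<lambda>y. c (h * x * y) = i) U) U"
      using Hfin by (intro eventually_ball_finite) auto
    with UG UH[OF Hfin(1)]
    have "eventually (\<lambda>x. x \<in> G \<and> x \<notin> H \<and> (\<forall>h\<in>H. c (h * x) = i \<and> eventually (\<lambda>y. c (h * x * y) = i) U)) U"
      by eventually_elim simp
    then obtain x where x: "x \<in> G" "x \<notin> H"
      "\<And>h. h \<in> H \<Longrightarrow> c (h * x) = i \<and> eventually (\<lambda>y. c (h * x * y) = i) U"
      using eventually_happens U(2) by blast
    define H' where "H' = H \<union> (\<lambda>h. h * x) ` H"
    have "P (Suc n) H'"
      using H x finite_subspace_adjoin[of H x] by (auto simp: P_def H'_def)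
    moreover have "x \<in> H'" using H x(1) one_mult[of x]
      by (auto simp: H'_def P_def finite_subspace_def intro!: image_eqI[of _ _ e])
    ultimately show "\<exists>H'. P (Suc n) H' \<and> H \<subset> H'" using x(2) by (auto simp: H'_def)
  qed
  then obtain f where f: "\<And>n. P n (f n)" "\<And>n. f n \<subset> f (Suc n)" by blast
  define T where "T = (\<Union>n. f n)"
  have mono: "f m \<subseteq> f n" if "m \<le> n" for m n
    by (rule lift_Suc_mono_le[OF _ that]) (use f(2) in blast)
  have "infinite T"
  proof
    assume T: "finite T"
    have "n \<le> card (f n)" for n
    proof (induction n)
      case (Suc n)
      have "card (f n) < card (f (Suc n))"
        using f by (intro psubset_card_mono) (auto simp: P_def finite_subspace_def)
      then show ?case using Suc by simp
    qed simp
    moreover have "card (f n) \<le> card T" for n using T by (intro card_mono) (auto simp: T_def)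
    ultimately show False by (meson Suc_n_not_le_n order_trans)
  qed
  moreover have "subsemigroup T"
    unfolding subsemigroup_def
  proof (intro conjI ballI)
    show "T \<noteq> {}" using \<open>infinite T\<close> by auto
    fix a b assume "a \<in> T" "b \<in> T"
    then obtain m n where "a \<in> f m" "b \<in> f n" by (auto simp: T_def)
    then have "a \<in> f (max m n)" "b \<in> f (max m n)" using mono[of m "max m n"] mono[of n "max m n"] by auto
    then show "a * b \<in> T" using f(1)[of "max m n"] by (auto simp: T_def P_def finite_subspace_def)
  qed
  moreover have "almost_monochromatic c T"
    unfolding almost_monochromatic_def
  proof (intro exI)
    have "{x \<in> T. c x \<noteq> i} \<subseteq> {e}" using f(1) by (auto simp: T_def P_def)
    then show "finite {x \<in> T. c x \<noteq> i}" using finite_subset by blast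
  qed
  moreover have "T \<subseteq> G"
    unfolding T_def using f(1) by (intro UN_least) (simp add: P_def finite_subspace_def)
  ultimately show ?thesis by blast
qed

section \<open>The characterization\<close>

lemma finitely_synchronizing_imp_almost_monochromatic:
  fixes T :: "'a::semigroup_mult set"
  assumes T: "infinite T" "finitely_synchronizing T" and c: "finite_coloring c"
  shows "\<exists>T'\<subseteq>T. subsemigroup T' \<and> infinite T' \<and> almost_monochromatic c T'"
proof -
  obtain F where F: "finite F" "F \<subseteq> T" "\<And>a b. a \<in> T \<Longrightarrow> b \<in> T \<Longrightarrow> a * b \<in> {a, b} \<union> F"
    using T(2) by (auto simp: finitely_synchronizing_def)
  obtain k where "coloring k c" using c by (auto simp: finite_coloring_def)
  then have "c ` T \<subseteq> {..<k}" by (auto simp: coloring_def)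
  then have "finite (c ` T)" using finite_subset by blast
  then obtain a where a: "infinite {x \<in> T. c x = c a}" using pigeonhole_infinite[OF T(1)] by blast
  define A where "A = {x \<in> T. c x = c a}"
  show ?thesis
  proof (intro exI conjI)
    show "A \<union> F \<subseteq> T" using F(2) by (auto simp: A_def)
    show "infinite (A \<union> F)" using a by (simp add: A_def)
    show "subsemigroup (A \<union> F)"
      unfolding subsemigroup_def
    proof (intro conjI ballI)
      show "A \<union> F \<noteq> {}" using infinite_imp_nonempty[OF a] by (auto simp: A_def)
      show "x * y \<in> A \<union> F" if "x \<in> A \<union> F" "y \<in> A \<union> F" for x y
      proof -
        have "x \<in> T" "y \<in> T" using that F(2) by (auto simp: A_def)
        then show ?thesis using F(3)[of x y] that by auto
      qed
    qed
    have "{x \<in> A \<union> F. c x \<noteq> c a} \<subseteq> F" by (auto simp: A_def)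
    then show "almost_monochromatic c (A \<union> F)"
      unfolding almost_monochromatic_def using F(1) finite_subset by blast
  qed
qed

lemma two_coloring_imp_contains_fs_or_direct_sum_Z2:
  assumes two: "\<forall>c :: 'a::semigroup_mult \<Rightarrow> nat. coloring 2 c \<longrightarrow>
      (\<exists>T. subsemigroup T \<and> infinite T \<and> almost_monochromatic c T)"
    and no: "\<not> contains_fs (UNIV :: 'a set)"
  shows "\<exists>T :: 'a set. subsemigroup T \<and> isomorphic_to_direct_sum_Z2 T"
proof -
  obtain c :: "'a \<Rightarrow> nat" where c: "coloring 2 c" and sq: "\<And>x. \<not> periodic x \<Longrightarrow> c (x * x) \<noteq> c x"
    and iv: "\<And>x y. periodic x \<Longrightarrow> periodic y \<Longrightarrow> group_inverse x y \<Longrightarrow> x \<noteq> y \<Longrightarrow> c x \<noteq> c y"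
    by (rule square_and_inverse_separating_coloring) (rule that)
  obtain T where T: "subsemigroup T" "infinite T" "almost_monochromatic c T" using two c by blast
  have per: "periodic x" if "x \<in> T" for x
    using almost_monochromatic_imp_periodic[OF sq T(1,3) that] .
  have "\<not> contains_fs T" using no contains_fs_mono by blast
  then obtain G e where G: "G \<subseteq> T" "infinite G" "is_subgroup G e"
    using shevrin[OF T(1,2)] per by metis
  obtain i where "finite {x \<in> T. c x \<noteq> i}" using T(3) by (auto simp: almost_monochromatic_def)
  then have "finite {x \<in> G. c x \<noteq> i}" by (rule rev_finite_subset) (use G(1) in auto)
  then have mono: "almost_monochromatic c G" unfolding almost_monochromatic_def by blast
  have inv: "g * g = e" if "g \<in> G" for g
  proof (rule almost_monochromatic_group_imp_involutive[OF G(3,2) _ mono _ that])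
    show "periodic x" if "x \<in> G" for x using per G(1) that by blast
    show "c x \<noteq> c y" if "periodic x" "periodic y" "group_inverse x y" "x \<noteq> y" for x y
      using that by (rule iv)
  qed
  interpret involutive_group G e
    by unfold_locales (use G(3) inv in \<open>auto simp: is_subgroup_def\<close>)
  show ?thesis using embeds_direct_sum_Z2[OF G(2)] by blast
qed

theorem theorem3p5:
  fixes cond1 cond2 cond3 :: bool
  defines "cond1 \<equiv> (\<forall>c :: 'a::semigroup_mult \<Rightarrow> nat. finite_coloring c \<longrightarrow>
      (\<exists>T. subsemigroup T \<and> infinite T \<and> almost_monochromatic c T))"
    and "cond2 \<equiv> (\<forall>c :: 'a \<Rightarrow> nat. coloring 2 c \<longrightarrow>
      (\<exists>T. subsemigroup T \<and> infinite T \<and> almost_monochromatic c T))"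
    and "cond3 \<equiv> (\<exists>T :: 'a set. subsemigroup T \<and> infinite T \<and> finitely_synchronizing T) \<or>
      (\<exists>T :: 'a set. subsemigroup T \<and> isomorphic_to_direct_sum_Z2 T)"
  shows "(cond1 \<longleftrightarrow> cond2) \<and> (cond2 \<longleftrightarrow> cond3)"
proof -
  have "cond2" if cond1
    using that unfolding cond1_def cond2_def finite_coloring_def by blast
  moreover have "cond3" if cond2
    using that two_coloring_imp_contains_fs_or_direct_sum_Z2
    unfolding cond2_def cond3_def contains_fs_def by blast
  moreover have "cond1" if cond3
    unfolding cond1_def
  proof (intro allI impI)
    fix c :: "'a \<Rightarrow> nat" assume c: "finite_coloring c"
    from \<open>cond3\<close> consider T :: "'a set" where "infinite T" "finitely_synchronizing T"
      | T :: "'a set" where "isomorphic_to_direct_sum_Z2 T"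
      unfolding cond3_def by blast
    then show "\<exists>T. subsemigroup T \<and> infinite T \<and> almost_monochromatic c T"
    proof cases
      case 1
      then show ?thesis using finitely_synchronizing_imp_almost_monochromatic c by blast
    next
      case 2
      then show ?thesis
        using isomorphic_to_direct_sum_Z2_imp_involutive_group[of T]
          involutive_group.almost_monochromatic_subgroup_exists[of T _ c] c by blast
    qed
  qed
  ultimately show ?thesis by blast
qed

end
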